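(* Let $\phi:[0,1]\to[0,1]$ be a strictly increasing continuous function whose fixed points in $(0,1)$ are exactly $a_1<\dots<a_{k-1}$ ($k\ge2$). Put $a_0=0$, $a_k=1$, and for $1\le i\le k$ let $$\phi_i(x)=\frac{\phi\big(x(a_i-a_{i-1})+a_{i-1}\big)-a_{i-1}}{a_i-a_{i-1}},\qquad x\in[0,1].$$ Define $D_i(\lambda)=1+\sum_{n=1}^\infty(-\lambda)^n\int_0^1\int_{\phi_i(t_1)}^1\cdots\int_{\phi_i(t_{n-1})}^1dt_n\cdots dt_1$ if $\phi_i(x)>x$ for $x\in(0,1)$, and $D_i(\lambda)=1$ if $\phi_i(x)<x$ for $x\in(0,1)$. Let $V_\phi$ be the operator on $L_2[0,1]$ given by $(V_\phi f)(x)=\int_0^{\phi(x)}f(t)\,dt$. Then, for $\lambda\neq0$: (1) $1/\lambda\in\sigma_p(V_\phi)$ if and only if $\prod_{i=1}^k D_i\big((a_i-a_{i-1})\lambda\big)=0$; (2) the algebraic multiplicity of the eigenvalue $1/\lambda$ equals the multiplicity of $\lambda$ as a root of the entire function $\prod_{i=1}^kD_i\big((a_i-a_{i-1})\lambda\big)$.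
   Context: $\sigma_p$ denotes the point spectrum. For each $i$, $\phi_i$ either satisfies $\phi_i(x)>x$ on all of $(0,1)$ or $\phi_i(x)<x$ on all of $(0,1)$, since $\phi$ has no fixed points inside $(a_{i-1},a_i)$. *)

theory Defs
  imports "HOL-Analysis.Analysis" "HOL-Complex_Analysis.Complex_Analysis"
begin

definition L2_01 :: "(real \<Rightarrow> complex) \<Rightarrow> bool" where
  "L2_01 f \<longleftrightarrow> f measurable_on {0..1} \<and> (\<lambda>x. (norm (f x))\<^sup>2) integrable_on {0..1}"

definition ae_zero_01 :: "(real \<Rightarrow> complex) \<Rightarrow> bool" where
  "ae_zero_01 f \<longleftrightarrow> negligible {x \<in> {0..1}. f x \<noteq> 0}"

definition ae_eq_01 :: "(real \<Rightarrow> complex) \<Rightarrow> (real \<Rightarrow> complex) \<Rightarrow> bool" where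
  "ae_eq_01 f g \<longleftrightarrow> negligible {x \<in> {0..1}. f x \<noteq> g x}"

definition Vop :: "(real \<Rightarrow> real) \<Rightarrow> (real \<Rightarrow> complex) \<Rightarrow> real \<Rightarrow> complex" where
  "Vop phi f = (\<lambda>x. integral {0..phi x} f)"

definition point_spectrum :: "(real \<Rightarrow> real) \<Rightarrow> complex set" where
  "point_spectrum phi =
     {mu. \<exists>f. L2_01 f \<and> \<not> ae_zero_01 f \<and> ae_eq_01 (Vop phi f) (\<lambda>x. mu * f x)}"

definition Vshift :: "(real \<Rightarrow> real) \<Rightarrow> complex \<Rightarrow> (real \<Rightarrow> complex) \<Rightarrow> real \<Rightarrow> complex" where
  "Vshift phi mu f = (\<lambda>x. Vop phi f x - mu * f x)"

definition gen_eigenspace :: "(real \<Rightarrow> real) \<Rightarrow> complex \<Rightarrow> (real \<Rightarrow> complex) set" where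
  "gen_eigenspace phi mu = {f. L2_01 f \<and> (\<exists>n. ae_zero_01 ((Vshift phi mu ^^ n) f))}"

text \<open>Algebraic multiplicity: dimension of the generalized eigenspace, as a subspace of
  L_2[0,1] (i.e. linear independence modulo a.e.-null functions).\<close>
definition alg_mult :: "(real \<Rightarrow> real) \<Rightarrow> complex \<Rightarrow> enat" where
  "alg_mult phi mu = Sup {enat m | m. \<exists>fs :: nat \<Rightarrow> real \<Rightarrow> complex.
      (\<forall>i<m. fs i \<in> gen_eigenspace phi mu) \<and>
      (\<forall>c :: nat \<Rightarrow> complex. ae_zero_01 (\<lambda>x. \<Sum>i<m. c i * fs i x) \<longrightarrow> (\<forall>i<m. c i = 0))}"

definition subphi :: "(real \<Rightarrow> real) \<Rightarrow> (nat \<Rightarrow> real) \<Rightarrow> nat \<Rightarrow> real \<Rightarrow> real" where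
  "subphi phi a i x = (phi (x * (a i - a (i - 1)) + a (i - 1)) - a (i - 1)) / (a i - a (i - 1))"

fun nest :: "(real \<Rightarrow> real) \<Rightarrow> nat \<Rightarrow> real \<Rightarrow> real" where
  "nest p 0 s = 1"
| "nest p (Suc m) s = integral {p s..1} (nest p m)"

text \<open>iter_int p n = int_0^1 int_{p t_1}^1 ... int_{p t_(n-1)}^1 dt_n ... dt_1  (n >= 1)\<close>
definition iter_int :: "(real \<Rightarrow> real) \<Rightarrow> nat \<Rightarrow> real" where
  "iter_int p n = integral {0..1} (nest p (n - 1))"

definition Dfun :: "(real \<Rightarrow> real) \<Rightarrow> complex \<Rightarrow> complex" where
  "Dfun p z = (if \<forall>x\<in>{0<..<1}. p x > x
      then 1 + (\<Sum>n. (- z) ^ Suc n * complex_of_real (iter_int p (Suc n)))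
      else 1)"

end

theory Submission
  imports Defs "HOL-Library.Function_Algebras"
begin

text \<open>
  The functions supported to the right of a fixed point form an invariant subspace of \<open>V\<close>, so the
  fixed points make \<open>V\<close> block triangular, and the generalized kernel of \<open>1 - \<lambda> V\<close> is an iterated extension of
  those of the blocks. If \<open>\<phi> x < x\<close> on a block, the block of \<open>V\<close> is a Volterra operator, so
  \<open>1 - \<lambda> V\<close> is bijective there. If \<open>\<phi> x > x\<close> on \<open>(b, c)\<close>, then \<open>V f = \<langle>f\<rangle> 1 - K f\<close>, where
  \<open>\<langle>f\<rangle>\<close> is the integral over the block and \<open>K f x\<close>, the integral of \<open>f\<close> from \<open>\<phi> x\<close> to \<open>c\<close>, is
  Volterra, and \<open>D z = 1 - z \<langle>(1 + z K)\<^sup>-\<^sup>1 1\<rangle>\<close>. With \<open>R = (1 + \<lambda> K)\<^sup>-\<^sup>1\<close> and \<open>w = (z - \<lambda>) / z\<close> one has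
  \<open>D z = 1 - \<lambda> (\<langle>R 1\<rangle> + w \<langle>R\<^sup>2 1\<rangle> + w\<^sup>2 \<langle>R\<^sup>3 1\<rangle> + \<dots>)\<close>, while
  \<open>(1 - \<lambda> V) R\<^sup>k\<^sup>+\<^sup>1 1 = R\<^sup>k 1 - \<lambda> \<langle>R\<^sup>k\<^sup>+\<^sup>1 1\<rangle> 1\<close>; hence \<open>D\<close> vanishes at \<open>\<lambda>\<close> to order \<open>m\<close> exactly if
  \<open>R 1, \<dots>, R\<^sup>m 1\<close> is a maximal Jordan chain.
\<close>

section \<open>Generalized kernels of linear maps on subspaces\<close>

locale vector_space_hom = vector_space scale
  for scale :: "'a::field \<Rightarrow> 'b::ab_group_add \<Rightarrow> 'b"
begin

text \<open>Linearity is demanded only on \<open>U\<close>, because the integral operators studied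
  below are additive only where the functions are integrable.\<close>

definition hom_on :: "'b set \<Rightarrow> ('b \<Rightarrow> 'b) \<Rightarrow> bool" where
  "hom_on U T \<longleftrightarrow> (\<forall>x\<in>U. \<forall>y\<in>U. T (x + y) = T x + T y) \<and> (\<forall>c. \<forall>x\<in>U. T (scale c x) = scale c (T x))"

definition linear_on :: "'b set \<Rightarrow> ('b \<Rightarrow> 'b) \<Rightarrow> bool" where
  "linear_on U T \<longleftrightarrow> subspace U \<and> T ` U \<subseteq> U \<and> hom_on U T"

definition nil_space :: "'b set \<Rightarrow> ('b \<Rightarrow> 'b) \<Rightarrow> 'b set" where
  "nil_space U T = {x \<in> U. \<exists>n. (T ^^ n) x = 0}"

definition has_dim :: "'b set \<Rightarrow> nat \<Rightarrow> bool" where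
  "has_dim U M \<longleftrightarrow> (\<exists>B. finite B \<and> independent B \<and> card B = M \<and> span B = U)"

text \<open>The last clause, a weak form of the Fitting decomposition, is what allows a generalized kernel
  vector of a quotient to be lifted.\<close>
definition riesz :: "'b set \<Rightarrow> ('b \<Rightarrow> 'b) \<Rightarrow> nat \<Rightarrow> bool" where
  "riesz U T M \<longleftrightarrow> linear_on U T \<and> has_dim (nil_space U T) M \<and>
     (\<forall>x\<in>U. \<exists>e\<in>nil_space U T. \<exists>y\<in>U. x = e + T y)"

lemma hom_on_add: "hom_on U T \<Longrightarrow> x \<in> U \<Longrightarrow> y \<in> U \<Longrightarrow> T (x + y) = T x + T y"
  and hom_on_scale: "hom_on U T \<Longrightarrow> x \<in> U \<Longrightarrow> T (scale c x) = scale c (T x)"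
  by (auto simp: hom_on_def)

lemma hom_on_0:
  assumes "subspace U" "hom_on U T" shows "T 0 = 0"
  using hom_on_scale[of U T 0 0] assms subspace_0 by auto

lemma hom_on_diff:
  assumes "subspace U" "hom_on U T" "x \<in> U" "y \<in> U" shows "T (x - y) = T x - T y"
proof -
  have "x + scale (- 1) y = x - y" by simp
  moreover have "T (x + scale (- 1) y) = T x + scale (- 1) (T y)"
    using assms by (simp add: hom_on_add hom_on_scale subspace_scale del: scale_minus_left)
  ultimately show ?thesis by simp
qed

lemma linear_onD:
  assumes "linear_on U T"
  shows "subspace U" "hom_on U T" "x \<in> U \<Longrightarrow> T x \<in> U"
  using assms by (auto simp: linear_on_def)

lemma linear_on_funpow:
  assumes "linear_on U T"
  shows "linear_on U (T ^^ n)"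
  using assms
  by (induction n) (auto simp: linear_on_def hom_on_def image_subset_iff)

lemma funpow_zero_mono:
  assumes "linear_on U T" "(T ^^ n) x = 0" "n \<le> m"
  shows "(T ^^ m) x = 0"
proof -
  have "(T ^^ m) x = (T ^^ (m - n)) ((T ^^ n) x)"
    using assms(3) by (metis comp_apply funpow_add le_add_diff_inverse2)
  then show ?thesis
    using assms(2) linear_on_funpow[OF assms(1)] by (metis hom_on_0 linear_onD(1,2))
qed

lemma subspace_nil_space:
  assumes "linear_on U T"
  shows "subspace (nil_space U T)"
proof (rule subspaceI)
  show "0 \<in> nil_space U T"
    using linear_onD(1)[OF assms] by (auto simp: nil_space_def subspace_0 intro: exI[of _ 0])
next
  fix x y assume "x \<in> nil_space U T" "y \<in> nil_space U T"
  then obtain n m where nm: "x \<in> U" "y \<in> U" "(T ^^ n) x = 0" "(T ^^ m) y = 0"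
    by (auto simp: nil_space_def)
  then have "(T ^^ (n + m)) x = 0" "(T ^^ (n + m)) y = 0"
    using funpow_zero_mono[OF assms] by (meson le_add1, meson le_add2)
  then have "(T ^^ (n + m)) (x + y) = 0"
    using hom_on_add[OF linear_onD(2)[OF linear_on_funpow[OF assms]]] nm by simp
  then show "x + y \<in> nil_space U T"
    using nm linear_onD(1)[OF assms] by (auto simp: nil_space_def subspace_add)
next
  fix c x assume "x \<in> nil_space U T"
  then obtain n where n: "x \<in> U" "(T ^^ n) x = 0" by (auto simp: nil_space_def)
  then have "(T ^^ n) (scale c x) = 0"
    using hom_on_scale[OF linear_onD(2)[OF linear_on_funpow[OF assms]]] by simp
  then show "scale c x \<in> nil_space U T"
    using n linear_onD(1)[OF assms] by (auto simp: nil_space_def subspace_scale)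
qed

text \<open>A form of rank-nullity: a basis of the kernel of \<open>S\<close> on \<open>U\<close> is
  enlarged by one preimage for each element of \<open>B\<close>.\<close>

lemma has_dim_vimage_span:
  assumes "subspace U" "hom_on U S" "has_dim {x \<in> U. S x = 0} M"
    and "finite B" "independent B" "B \<subseteq> S ` U"
  shows "has_dim {x \<in> U. S x \<in> span B} (M + card B)"
  using assms(4-6)
proof (induction B)
  case empty
  then show ?case using assms(3) by simp
next
  case (insert y B)
  then have y: "y \<notin> span B" "independent B" by (simp_all add: independent_insert)
  with insert obtain C where C: "finite C" "independent C" "card C = M + card B"
    "span C = {x \<in> U. S x \<in> span B}"
    by (auto simp: has_dim_def)
  obtain x where x: "x \<in> U" "S x = y" using insert.prems by auto
  have "x \<notin> span C" using x y C by auto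
  then have xC: "x \<notin> C" by (meson span_base)
  have "z \<in> span (insert x C) \<longleftrightarrow> z \<in> U \<and> S z \<in> span (insert y B)" for z
  proof -
    have "z \<in> span (insert x C) \<longleftrightarrow> (\<exists>k. z - scale k x \<in> U \<and> S (z - scale k x) \<in> span B)"
      unfolding span_breakdown_eq C(4) by simp
    also have "\<dots> \<longleftrightarrow> z \<in> U \<and> (\<exists>k. S z - scale k y \<in> span B)"
    proof -
      have "z - scale k x \<in> U \<longleftrightarrow> z \<in> U" for k
        using x(1) assms(1) by (metis diff_add_cancel subspace_add subspace_diff subspace_scale)
      moreover have "S (z - scale k x) = S z - scale k y" if "z \<in> U" for k
        using that x assms(1,2) by (simp add: hom_on_diff hom_on_scale subspace_scale)
      ultimately show ?thesis by auto
    qed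
    finally show ?thesis by (simp add: span_breakdown_eq)
  qed
  then have "span (insert x C) = {z \<in> U. S z \<in> span (insert y B)}" by auto
  moreover have "independent (insert x C)"
    using C \<open>x \<notin> span C\<close> by (simp add: independent_insert)
  ultimately show ?case
    unfolding has_dim_def using C xC insert by (intro exI[of _ "insert x C"]) auto
qed

section \<open>Additivity of the multiplicity in exact sequences\<close>

text \<open>The splitting \<open>x = e + T y\<close> is substituted repeatedly into its own
  \<open>y\<close>. The terms \<open>(T ^^ n) e'\<close> that arise stay in the generalized kernel,
  since powers of \<open>T\<close> commute.\<close>

lemma riesz_funpow:
  assumes "riesz U T M" "x \<in> U"
  shows "\<exists>e\<in>nil_space U T. \<exists>y\<in>U. x = e + (T ^^ n) y"
  using assms(2)
proof (induction n arbitrary: x)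
  case 0
  have "0 \<in> nil_space U T"
    using assms(1) by (auto simp: riesz_def intro: subspace_0 subspace_nil_space)
  then show ?case using 0 by (metis add_0 funpow_0)
next
  case (Suc n)
  have lin: "linear_on U T" using assms(1) by (simp add: riesz_def)
  obtain e y where e: "e \<in> nil_space U T" "y \<in> U" "x = e + (T ^^ n) y"
    using Suc by blast
  obtain e' y' where e': "e' \<in> nil_space U T" "y' \<in> U" "y = e' + T y'"
    using assms(1) e(2) by (auto simp: riesz_def)
  have U: "e' \<in> U" "T y' \<in> U" using e' lin by (auto simp: nil_space_def linear_onD)
  obtain r where r: "(T ^^ r) e' = 0" using e' by (auto simp: nil_space_def)
  have "(T ^^ r) ((T ^^ n) e') = (T ^^ (r + n)) e'" by (simp add: funpow_add)
  also have "\<dots> = 0" using funpow_zero_mono[OF lin r] by simp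
  finally have "(T ^^ n) e' \<in> nil_space U T"
    using U linear_onD(3)[OF linear_on_funpow[OF lin]] by (auto simp: nil_space_def)
  then have "e + (T ^^ n) e' \<in> nil_space U T"
    using e(1) subspace_add subspace_nil_space[OF lin] by blast
  moreover have "x = (e + (T ^^ n) e') + (T ^^ Suc n) y'"
    unfolding e(3) e'(3) hom_on_add[OF linear_onD(2)[OF linear_on_funpow[OF lin]] U]
    by (simp add: funpow_swap1 add.assoc)
  ultimately show ?case using e'(2) by blast
qed

text \<open>\<open>Y\<close>, \<open>X\<close>, \<open>Z\<close> form a short exact sequence
  compatible with the maps. The generalized kernels again form a short exact sequence, so their
  dimensions add; the delicate point is that generalized kernel vectors of the quotient
  \<open>Z\<close> can be lifted.\<close>

lemma riesz_extension:
  assumes Y: "riesz Y T M" and Z: "riesz Z T' N" and X: "linear_on X T"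
    and S: "hom_on X S" "S ` X = Z" and ker: "Y = {x \<in> X. S x = 0}"
    and comm: "\<And>x. x \<in> X \<Longrightarrow> S (T x) = T' (S x)"
  shows "riesz X T (N + M)"
proof -
  have linY: "linear_on Y T" and linZ: "linear_on Z T'" using Y Z by (auto simp: riesz_def)
  have subX: "subspace X" using X by (rule linear_onD)
  have funpow_in: "(T ^^ n) x \<in> X" if "x \<in> X" for n x
    using that linear_onD(3)[OF linear_on_funpow[OF X]] by blast
  have comm_pow: "S ((T ^^ n) x) = (T' ^^ n) (S x)" if "x \<in> X" for n x
    using that by (induction n) (auto simp: comm funpow_in)
  define E where "E = nil_space X T"
  have subE: "subspace E" unfolding E_def by (rule subspace_nil_space[OF X])
  have EX: "E \<subseteq> X" by (auto simp: E_def nil_space_def)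
  have YX: "Y \<subseteq> X" using ker by auto
  have EY: "nil_space Y T \<subseteq> E" using YX by (auto simp: E_def nil_space_def)
  have SE: "S ` E = nil_space Z T'"
  proof (intro subset_antisym subsetI)
    fix z assume "z \<in> S ` E"
    then obtain x n where x: "x \<in> X" "z = S x" "(T ^^ n) x = 0" by (auto simp: E_def nil_space_def)
    then have "(T' ^^ n) z = 0" using comm_pow[of x n] hom_on_0[OF subX S(1)] by simp
    then show "z \<in> nil_space Z T'" using x S(2) by (auto simp: nil_space_def)
  next
    fix z assume "z \<in> nil_space Z T'"
    then obtain n where n: "z \<in> Z" "(T' ^^ n) z = 0" by (auto simp: nil_space_def)
    then obtain x where x: "x \<in> X" "S x = z" using S(2) by auto
    \<comment> \<open>The lift \<open>x\<close> itself need not be killed by a power of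
      \<open>T\<close>. Splitting \<open>(T ^^ n) x\<close> as \<open>e + (T ^^ n) y\<close> inside
      \<open>Y\<close> shows that the corrected lift \<open>x - y\<close> is.\<close>
    have "(T ^^ n) x \<in> Y" using comm_pow[OF x(1)] n x funpow_in ker by simp
    then obtain e y where ey: "e \<in> nil_space Y T" "y \<in> Y" "(T ^^ n) x = e + (T ^^ n) y"
      using riesz_funpow[OF Y] by blast
    obtain r where r: "(T ^^ r) e = 0" using ey by (auto simp: nil_space_def)
    have y: "y \<in> X" "S y = 0" using ey ker by auto
    have "(T ^^ n) (x - y) = e"
      using hom_on_diff[OF linear_onD(1,2)[OF linear_on_funpow[OF X]] x(1) y(1)] ey(3) by simp
    then have "(T ^^ (r + n)) (x - y) = 0" using r by (simp add: funpow_add)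
    then have "x - y \<in> E" using x y subX by (auto simp: E_def nil_space_def subspace_diff)
    moreover have "S (x - y) = z" using hom_on_diff[OF subX S(1) x(1) y(1)] x y by simp
    ultimately show "z \<in> S ` E" by blast
  qed
  have "has_dim E (N + M)"
  proof -
    obtain B where B: "finite B" "independent B" "card B = N" "span B = nil_space Z T'"
      using Z by (auto simp: riesz_def has_dim_def)
    have "{x \<in> E. S x = 0} = nil_space Y T" using ker by (auto simp: E_def nil_space_def)
    then have "has_dim {x \<in> E. S x = 0} M" using Y by (simp add: riesz_def)
    moreover have "hom_on E S" using S(1) EX unfolding hom_on_def by blast
    moreover have "B \<subseteq> S ` E" using B SE span_base by blast
    ultimately have "has_dim {x \<in> E. S x \<in> span B} (M + card B)"
      using has_dim_vimage_span[OF subE] B by blast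
    moreover have "{x \<in> E. S x \<in> span B} = E" using B SE by auto
    ultimately show ?thesis using B by (simp add: add.commute)
  qed
  moreover have "\<exists>e\<in>E. \<exists>y\<in>X. x = e + T y" if x: "x \<in> X" for x
  proof -
    \<comment> \<open>The splitting of \<open>S x\<close> in \<open>Z\<close> is lifted to
      \<open>X\<close>; the error lies in the kernel \<open>Y\<close> and is split there.\<close>
    obtain e z where ez: "e \<in> nil_space Z T'" "z \<in> Z" "S x = e + T' z"
      using Z x S(2) unfolding riesz_def by blast
    obtain e' z' where e': "e' \<in> E" "S e' = e" "z' \<in> X" "S z' = z"
      using ez S(2) SE by (metis imageE)
    have in_X: "e' \<in> X" "T z' \<in> X" "x - e' \<in> X"
      using e' EX linear_onD(3)[OF X] x subX by (auto simp: subspace_diff)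
    have "S (x - e' - T z') = S x - S e' - S (T z')"
      using in_X x hom_on_diff[OF subX S(1)] by simp
    also have "\<dots> = 0" using e' ez comm by simp
    finally have "x - e' - T z' \<in> Y" using ker in_X subX by (auto simp: subspace_diff)
    then obtain e'' y where ey: "e'' \<in> nil_space Y T" "y \<in> Y" "x - e' - T z' = e'' + T y"
      using Y by (auto simp: riesz_def)
    have "x = (e' + e'') + T (z' + y)"
      using ey YX e' hom_on_add[OF linear_onD(2)[OF X], of z' y] by (auto simp: algebra_simps)
    moreover have "e' + e'' \<in> E" "z' + y \<in> X"
      using ey e' EY YX subE subX by (auto intro: subspace_add)
    ultimately show ?thesis by blast
  qed
  ultimately show ?thesis using X by (simp add: riesz_def E_def)
qed

section \<open>Bijections and rank one perturbations of bijections\<close>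

text \<open>Serves both the Volterra operators and the case \<open>m = 0\<close> of a rank one
  perturbation.\<close>

lemma riesz_bij:
  assumes lin: "linear_on Z T" and inj: "\<And>x. x \<in> Z \<Longrightarrow> T x = 0 \<Longrightarrow> x = 0"
    and surj: "\<And>x. x \<in> Z \<Longrightarrow> \<exists>y\<in>Z. x = T y"
  shows "riesz Z T 0"
proof -
  have "x = 0" if "x \<in> Z" "(T ^^ n) x = 0" for n x
    using that
  proof (induction n)
    case (Suc n)
    then show ?case using inj[of "(T ^^ n) x"] linear_onD(3)[OF linear_on_funpow[OF lin]] by simp
  qed simp
  then have nil: "nil_space Z T = {0}"
    using linear_onD(1)[OF lin] by (auto simp: nil_space_def subspace_0 intro: exI[of _ 0])
  have "has_dim {0} 0" unfolding has_dim_def by (intro exI[of _ "{}"]) (simp add: independent_empty)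
  then show ?thesis using lin surj by (auto simp: riesz_def nil)
qed

text \<open>The Jordan chain is \<open>v k = R^(k+1) p\<close>: it satisfies \<open>T (v k) = v (k - 1) - F (v k) p\<close>,
  so it continues exactly as long as \<open>F (v k)\<close> vanishes.\<close>
lemma riesz_rank_one_perturbation:
  fixes F :: "'b \<Rightarrow> 'a" and T G R :: "'b \<Rightarrow> 'b"
  assumes lin: "linear_on Z T" and R: "\<And>x. x \<in> Z \<Longrightarrow> R x \<in> Z"
    and GR: "\<And>x. x \<in> Z \<Longrightarrow> G (R x) = x" and RG: "\<And>x. x \<in> Z \<Longrightarrow> R (G x) = x"
    and Rsc: "\<And>c x. x \<in> Z \<Longrightarrow> R (scale c x) = scale c (R x)"
    and p: "p \<in> Z" "p \<noteq> 0"
    and T: "\<And>x. x \<in> Z \<Longrightarrow> T x = G x - scale (F x) p"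
    and F: "\<And>k. k < m \<Longrightarrow> F ((R ^^ Suc k) p) = (if k = 0 then 1 else 0)"
    and Fm: "F ((R ^^ Suc m) p) \<noteq> (if m = 0 then 1 else 0)"
  shows "riesz Z T m"
proof -
  define v where "v k = (R ^^ Suc k) p" for k
  have Rn: "(R ^^ k) p \<in> Z" for k using R p by (induction k) auto
  have vZ: "v k \<in> Z" for k using Rn[of "Suc k"] by (simp add: v_def)
  have G: "G (v k) = (R ^^ k) p" for k unfolding v_def using GR[OF Rn[of k]] by simp
  have sub: "subspace Z" using lin by (rule linear_onD)
  note T_add = hom_on_add[OF linear_onD(2)[OF lin]]
    and T_diff = hom_on_diff[OF linear_onD(1,2)[OF lin]]
    and T_scale = hom_on_scale[OF linear_onD(2)[OF lin]]
  have v0: "v 0 \<noteq> 0"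
  proof
    assume "v 0 = 0"
    then have "G 0 = p" using G[of 0] by simp
    moreover have "R 0 = 0" using Rsc[OF p(1), of 0] by simp
    then have "G 0 = 0" using GR[of 0] sub by (simp add: subspace_0)
    ultimately show False using p by simp
  qed
  \<comment> \<open>As \<open>R\<close> inverts \<open>G\<close>, the preimage of the line through
    \<open>p\<close> is the line through \<open>v 0 = R p\<close>.\<close>
  have Gin: "\<exists>c. x = scale c (v 0)" if "x \<in> Z" "G x = scale c p" for x c
    using that RG[of x] Rsc[OF p(1), of c] by (auto simp: v_def)
  have T0: "T (v 0) = scale (1 - F (v 0)) p"
    using T[OF vZ] G[of 0] by (simp add: scale_left_diff_distrib)
  have TS: "T (v (Suc k)) = v k - scale (F (v (Suc k))) p" for k
    using T[OF vZ, of "Suc k"] G[of "Suc k"] by (simp add: v_def[symmetric] v_def[of k])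
  show ?thesis
  proof (cases m)
    case 0
    then have F0: "F (v 0) \<noteq> 1" using Fm by (simp add: v_def)
    have T_eq: "x = scale (F x + c) (v 0)" if "x \<in> Z" "T x = scale c p" for x c
    proof -
      have "G x = scale (F x + c) p" using T[OF that(1)] that(2) by (simp add: scale_left_distrib algebra_simps)
      then show ?thesis using RG[OF that(1)] Rsc[OF p(1)] by (metis v_def funpow_0 funpow.simps(2) o_apply)
    qed
    show ?thesis unfolding 0
    proof (rule riesz_bij[OF lin])
      fix x assume x: "x \<in> Z" "T x = 0"
      then have xe: "x = scale (F x) (v 0)" using T_eq[of x 0] by simp
      then have "T x = scale (F x) (scale (1 - F (v 0)) p)"
        using T_scale[OF vZ] T0 by metis
      then have "F x = 0" using x F0 p by simp
      then show "x = 0" using xe by simp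
    next
      fix x assume x: "x \<in> Z"
      \<comment> \<open>The Sherman-Morrison correction: \<open>T (R x)\<close> misses
        \<open>x\<close> by a multiple of \<open>p\<close>, and \<open>T (v 0)\<close> is a nonzero
        multiple of \<open>p\<close>.\<close>
      define s where "s = F (R x) / (1 - F (v 0))"
      have "T (R x + scale s (v 0)) = T (R x) + scale s (T (v 0))"
        using x R vZ sub by (simp add: T_add T_scale subspace_scale)
      also have "\<dots> = x - scale (F (R x)) p + scale (s * (1 - F (v 0))) p"
        using T[OF R[OF x]] GR[OF x] T0 by simp
      also have "\<dots> = x" using F0 by (simp add: s_def)
      finally show "\<exists>y\<in>Z. x = T y"
        using x R vZ sub by (metis subspace_add subspace_scale)
    qed
  next
    case (Suc m')
    have F0: "F (v 0) = 1" using F[of 0] Suc by (simp add: v_def)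
    have Fk: "F (v (Suc k)) = 0" if "k < m'" for k using F[of "Suc k"] that Suc by (simp add: v_def)
    have Fm': "F (v m) \<noteq> 0" using Fm Suc by (simp add: v_def)
    have Tv0: "T (v 0) = 0" using T0 F0 by simp
    have TvS: "T (v (Suc k)) = v k" if "k < m'" for k using TS Fk[OF that] by simp
    have Tvm: "T (v m) = v m' - scale (F (v m)) p" using TS Suc by simp
    \<comment> \<open>A preimage of \<open>p\<close> would be a multiple of \<open>v 0\<close>,
      which \<open>T\<close> annihilates because \<open>F (v 0) = 1\<close>.\<close>
    have p_notin: "T x \<noteq> p" if xZ: "x \<in> Z" for x
    proof
      assume "T x = p"
      then have "G x = scale (F x + 1) p" using T[OF that] by (simp add: scale_left_distrib algebra_simps)
      then obtain c where "x = scale c (v 0)" using Gin[OF xZ] by blast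
      then have "T x = 0" using T_scale[OF vZ] Tv0 by simp
      then show False using \<open>T x = p\<close> p by simp
    qed
    \<comment> \<open>The chain ends at \<open>v m'\<close>: the image of \<open>v m\<close> differs
      from \<open>v m'\<close> by a nonzero multiple of \<open>p\<close>, so a preimage of
      \<open>v m'\<close> would produce one of \<open>p\<close>.\<close>
    have v_notin: "T x \<noteq> v m'" if "x \<in> Z" for x
    proof
      assume "T x = v m'"
      then have "T (x - v m) = scale (F (v m)) p"
        using Tvm hom_on_diff[OF linear_onD(1,2)[OF lin] that vZ] by simp
      then have "T (scale (1 / F (v m)) (x - v m)) = p"
        using hom_on_scale[OF linear_onD(2)[OF lin], of "x - v m"] that vZ sub Fm'
        by (simp add: subspace_diff)
      moreover have "scale (1 / F (v m)) (x - v m) \<in> Z"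
        using that vZ sub by (intro subspace_scale subspace_diff)
      ultimately show False using p_notin by blast
    qed
    have Tpow: "(T ^^ n) (v k) = (if k < n then 0 else v (k - n))" if "k < m" for k n
    proof (induction n)
      case (Suc n)
      have "T 0 = 0" using lin by (metis hom_on_0 linear_onD(1,2))
      moreover have "T (v (k - n)) = v (k - Suc n)" if "n < k"
        using TvS[of "k - Suc n"] that \<open>k < m\<close> \<open>m = Suc m'\<close> by (simp add: Suc_diff_Suc)
      ultimately show ?case using Suc Tv0 by (cases "k < n"; cases "k = n"; simp)
    qed simp
    have nilv: "v k \<in> nil_space Z T" if "k < m" for k
      using Tpow[OF that, of "Suc k"] vZ unfolding nil_space_def
      by (auto simp del: funpow.simps intro!: exI[of _ "Suc k"])
    have spn_nil: "span (v ` {..<r}) \<subseteq> nil_space Z T" if "r \<le> m" for r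
      using that nilv by (intro span_minimal subspace_nil_space[OF lin]) auto
    have indep: "independent (v ` {..<r}) \<and> card (v ` {..<r}) = r" if "r \<le> m" for r
      using that
    proof (induction r)
      case (Suc r)
      \<comment> \<open>\<open>T ^^ r\<close> kills the first \<open>r\<close> chain vectors but
        sends \<open>v r\<close> to \<open>v 0\<close>, which is nonzero; hence \<open>v r\<close>
        is independent of them.\<close>
      have "span (v ` {..<r}) \<subseteq> {x \<in> Z. (T ^^ r) x = 0}"
      proof (rule span_minimal)
        show "v ` {..<r} \<subseteq> {x \<in> Z. (T ^^ r) x = 0}" using vZ Tpow Suc.prems by auto
        have l: "linear_on Z (T ^^ r)" by (rule linear_on_funpow[OF lin])
        show "subspace {x \<in> Z. (T ^^ r) x = 0}"
          using sub hom_on_0[OF linear_onD(1,2)[OF l]] hom_on_add[OF linear_onD(2)[OF l]]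
            hom_on_scale[OF linear_onD(2)[OF l]]
          by (auto simp: subspace_def)
      qed
      moreover have "(T ^^ r) (v r) = v 0" using Tpow Suc.prems by simp
      ultimately have "v r \<notin> span (v ` {..<r})" using v0 by auto
      moreover from this have "v r \<notin> v ` {..<r}" by (meson span_base)
      ultimately show ?case using Suc by (simp add: lessThan_Suc independent_insert)
    qed (simp add: independent_empty)
    have "x \<in> span (v ` {..<m})" if "x \<in> Z" "(T ^^ n) x = 0" for n x
      using that
    proof (induction n arbitrary: x)
      case 0
      then show ?case by (simp add: span_zero)
    next
      case (Suc n)
      have Tx: "T x \<in> Z" using Suc.prems lin by (auto simp: linear_onD)
      have "(T ^^ n) (T x) = 0" using Suc.prems by (simp add: funpow_swap1)
      then have "T x \<in> span (v ` {..<m})" using Suc.IH Tx by blast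
      then have "T x \<in> span (insert (v m') (v ` {..<m'}))"
        by (simp add: \<open>m = Suc m'\<close> lessThan_Suc)
      then obtain c where c: "T x - scale c (v m') \<in> span (v ` {..<m'})"
        by (auto simp: span_breakdown_eq)
      \<comment> \<open>Raising each index by one inverts \<open>T\<close> on the span of all chain
        vectors except the last one, \<open>v m'\<close>.\<close>
      have "\<exists>s\<in>span (v ` {..<m}). T s = y" if "y \<in> span (v ` {..<m'})" for y
        using that
      proof (induction rule: span_induct_alt)
        case base
        show ?case using lin by (meson hom_on_0 linear_onD(1,2) span_zero)
      next
        case (step c b y)
        then obtain k s where ks: "k < m'" "b = v k" "s \<in> span (v ` {..<m})" "T s = y" by auto
        have "s \<in> Z" using ks spn_nil[of m] by (auto simp: nil_space_def)
        then have "T (scale c (v (Suc k)) + s) = scale c b + y"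
          using T_add hom_on_scale[OF linear_onD(2)[OF lin]]
            vZ sub TvS ks by (simp add: subspace_scale)
        moreover have "scale c (v (Suc k)) + s \<in> span (v ` {..<m})"
          using ks \<open>m = Suc m'\<close> by (intro span_add[OF span_scale[OF span_base] ks(3)]) auto
        ultimately show ?case by blast
      qed
      then obtain s where s: "s \<in> span (v ` {..<m})" "T s = T x - scale c (v m')" using c by blast
      have sZ: "s \<in> Z" using s spn_nil[of m] by (auto simp: nil_space_def)
      have Txs: "T (x - s) = scale c (v m')"
        using hom_on_diff[OF linear_onD(1,2)[OF lin] Suc.prems(1) sZ] s by simp
      \<comment> \<open>Otherwise \<open>v m'\<close> would lie in the range of \<open>T\<close>.
        Then \<open>x - s\<close> is in the kernel of \<open>T\<close>, which is spanned by
        \<open>v 0\<close>.\<close>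
      have "c = 0"
      proof (rule ccontr)
        assume "c \<noteq> 0"
        then have "T (scale (1 / c) (x - s)) = v m'"
          using hom_on_scale[OF linear_onD(2)[OF lin], of "x - s"] Suc.prems sZ sub Txs
          by (simp add: subspace_diff)
        moreover have "scale (1 / c) (x - s) \<in> Z"
          using Suc.prems(1) sZ sub by (intro subspace_scale subspace_diff)
        ultimately show False using v_notin by blast
      qed
      then have "T (x - s) = 0" using Txs by simp
      then obtain c' where "x - s = scale c' (v 0)"
        using Gin[of "x - s" "F (x - s)"] T[of "x - s"] Suc.prems(1) sZ sub
        by (auto simp: subspace_diff)
      then have "x = scale c' (v 0) + s" by (simp add: algebra_simps)
      moreover have "v 0 \<in> v ` {..<m}" using \<open>m = Suc m'\<close> by auto
      ultimately show ?case using span_add[OF span_scale[OF span_base] s(1)] by metis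
    qed
    then have nil_eq: "nil_space Z T = span (v ` {..<m})"
      using spn_nil[of m] by (auto simp: nil_space_def)
    have "\<exists>e\<in>nil_space Z T. \<exists>y\<in>Z. x = e + T y" if x: "x \<in> Z" for x
    proof -
      \<comment> \<open>This factor makes the multiples of \<open>p\<close> in
        \<open>T (R x)\<close> and in \<open>scale s (T (v m))\<close> equal, so that they cancel in
        the difference.\<close>
      define s where "s = F (R x) / F (v m)"
      have TRx: "T (R x) = x - scale (F (R x)) p" using T[OF R[OF x]] GR[OF x] by simp
      have "T (R x - scale s (v m)) = T (R x) - scale s (T (v m))"
        using x R vZ sub by (simp add: T_diff T_scale subspace_scale)
      also have "scale s (T (v m)) = scale s (v m') - scale (F (R x)) p"
        using Fm' by (simp add: Tvm s_def scale_right_diff_distrib)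
      finally have "x = scale s (v m') + T (R x - scale s (v m))"
        by (simp add: TRx algebra_simps)
      moreover have "scale s (v m') \<in> nil_space Z T"
        using nilv[of m'] \<open>m = Suc m'\<close> subspace_nil_space[OF lin] by (simp add: subspace_scale)
      moreover have "R x - scale s (v m) \<in> Z"
        using x R vZ sub by (simp add: subspace_diff subspace_scale)
      ultimately show ?thesis by blast
    qed
    moreover have "has_dim (nil_space Z T) m"
      unfolding has_dim_def nil_eq using indep[of m] by (intro exI[of _ "v ` {..<m}"]) simp
    ultimately show ?thesis using lin by (simp add: riesz_def)
  qed
qed

section \<open>Dimension counted by finite independent families\<close>

lemma has_dim_family_le:
  assumes "has_dim U M" "\<And>i. i < n \<Longrightarrow> f i \<in> U"
    and ind: "\<And>c i. (\<Sum>i<n. scale (c i) (f i)) = 0 \<Longrightarrow> i < n \<Longrightarrow> c i = 0"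
  shows "n \<le> M"
proof -
  obtain B where B: "finite B" "independent B" "card B = M" "span B = U"
    using assms(1) by (auto simp: has_dim_def)
  have inj: "inj_on f {..<n}"
  proof (rule inj_onI, rule ccontr)
    fix i j assume ij: "i \<in> {..<n}" "j \<in> {..<n}" "f i = f j" "i \<noteq> j"
    \<comment> \<open>Independence is a property of the set of values, so injectivity comes first: a
      repeated value would give a relation with coefficients 1 and -1.\<close>
    define c where "c = (\<lambda>l. if l = i then 1 else if l = j then -1 else (0 :: 'a))"
    have "(\<Sum>l<n. scale (c l) (f l)) = (\<Sum>l\<in>{i,j}. scale (c l) (f l))"
      using ij by (intro sum.mono_neutral_right) (auto simp: c_def)
    also have "\<dots> = 0" using ij by (simp add: c_def)
    finally show False using ind[of c i] ij by (simp add: c_def)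
  qed
  have "independent (f ` {..<n})"
  proof
    assume "dependent (f ` {..<n})"
    then obtain u v where u: "v \<in> f ` {..<n}" "u v \<noteq> 0" "(\<Sum>v\<in>f ` {..<n}. scale (u v) v) = 0"
      by (auto simp: dependent_finite)
    then have "(\<Sum>i<n. scale (u (f i)) (f i)) = 0" using inj by (simp add: sum.reindex)
    then show False using ind[of "u \<circ> f"] u by auto
  qed
  moreover have "f ` {..<n} \<subseteq> span B" using assms(2) B by auto
  ultimately have "card (f ` {..<n}) \<le> card B" using independent_span_bound B by blast
  then show ?thesis using inj B by (simp add: card_image)
qed

lemma has_dim_obtain_family:
  assumes "has_dim U M"
  obtains f :: "nat \<Rightarrow> 'b" where "\<And>i. i < M \<Longrightarrow> f i \<in> U"
    and "\<And>c i. (\<Sum>i<M. scale (c i) (f i)) = 0 \<Longrightarrow> i < M \<Longrightarrow> c i = 0"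
proof -
  obtain B where B: "finite B" "independent B" "card B = M" "span B = U"
    using assms by (auto simp: has_dim_def)
  obtain f where f: "bij_betw f {..<M} B"
    using B ex_bij_betw_nat_finite[OF B(1)] by (auto simp: lessThan_atLeast0)
  show ?thesis
  proof
    show "f i \<in> U" if "i < M" for i
    proof -
      have "f i \<in> B" using that f by (auto simp: bij_betw_def)
      then show ?thesis using B(4) span_base by blast
    qed
    fix c i assume c: "(\<Sum>i<M. scale (c i) (f i)) = 0" and i: "i < M"
    define g where "g = c \<circ> the_inv_into {..<M} f"
    have inv: "the_inv_into {..<M} f (f j) = j" if "j < M" for j
      using f that by (simp add: bij_betw_def the_inv_into_f_f)
    have "(\<Sum>v\<in>B. scale (g v) v) = (\<Sum>i<M. scale (g (f i)) (f i))"
      by (rule sum.reindex_bij_betw[OF f, symmetric])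
    also have "\<dots> = (\<Sum>i<M. scale (c i) (f i))" using inv by (intro sum.cong) (auto simp: g_def)
    also note c
    finally have "(\<Sum>v\<in>B. scale (g v) v) = 0" .
    moreover have "f i \<in> B" using f i by (auto simp: bij_betw_def)
    ultimately have "g (f i) = 0"
      using B(2) dependent_finite[OF B(1)] by blast
    then show "c i = 0" using inv[OF i] by (simp add: g_def)
  qed
qed

lemma riesz_cong:
  assumes "riesz U T M" "\<And>x. x \<in> U \<Longrightarrow> T' x = T x"
  shows "riesz U T' M"
proof -
  have lin: "linear_on U T" using assms(1) by (simp add: riesz_def)
  then have "linear_on U T'"
    using assms(2) linear_onD(1)[OF lin]
    by (auto simp: linear_on_def hom_on_def image_subset_iff subspace_add subspace_scale)
  moreover have "(T' ^^ n) x = (T ^^ n) x" if "x \<in> U" for n x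
    using that assms(2) linear_onD(3)[OF linear_on_funpow[OF lin]] by (induction n) auto
  then have "nil_space U T' = nil_space U T" by (auto simp: nil_space_def)
  ultimately show ?thesis using assms by (auto simp: riesz_def)
qed

text \<open>A nonzero generalized kernel contains a nonzero kernel vector, so the multiplicity also
  decides whether there is an eigenvector.\<close>

lemma riesz_eq_0_iff:
  assumes "riesz U T M"
  shows "M = 0 \<longleftrightarrow> (\<forall>x\<in>U. T x = 0 \<longrightarrow> x = 0)"
proof -
  have lin: "linear_on U T" using assms by (simp add: riesz_def)
  obtain B where B: "finite B" "independent B" "card B = M" "span B = nil_space U T"
    using assms by (auto simp: riesz_def has_dim_def)
  show ?thesis
  proof
    assume "M = 0"
    then have "nil_space U T = {0}" using B by simp
    then show "\<forall>x\<in>U. T x = 0 \<longrightarrow> x = 0"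
      unfolding nil_space_def by (metis (mono_tags, lifting) funpow_0 funpow_simps_right(2)
        mem_Collect_eq o_apply singletonD)
  next
    assume inj: "\<forall>x\<in>U. T x = 0 \<longrightarrow> x = 0"
    have "x = 0" if "x \<in> U" "(T ^^ n) x = 0" for n x
      using that
    proof (induction n)
      case (Suc n)
      then show ?case using inj linear_onD(3)[OF linear_on_funpow[OF lin]] by simp
    qed simp
    then have "span B \<subseteq> {0}" unfolding B(4) by (auto simp: nil_space_def)
    then have "B \<subseteq> {0}" using span_superset by blast
    moreover have "0 \<notin> B" using B(2) dependent_zero by blast
    ultimately show "M = 0" using B(3) by (metis card.empty subset_singletonD singletonI)
  qed
qed

end

section \<open>Volterra operators on bounded integrable functions\<close>

definition fscale :: "complex \<Rightarrow> (real \<Rightarrow> complex) \<Rightarrow> real \<Rightarrow> complex" where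
  "fscale c f = (\<lambda>x. c * f x)"

lemma fscale_apply [simp]: "fscale c f x = c * f x"
  by (simp add: fscale_def)

interpretation cfun: vector_space_hom fscale
  by unfold_locales (auto simp: fun_eq_iff algebra_simps)

lemma sum_fun_apply: "sum f A x = (\<Sum>i\<in>A. f i x)" for f :: "'i \<Rightarrow> real \<Rightarrow> complex"
  by (induction A rule: infinite_finite_induct) auto

text \<open>Functions are compared pointwise, not modulo null sets: every generalized eigenfunction for a
  nonzero eigenvalue agrees almost everywhere with exactly one that is such pointwise. The supports
  are half open so that consecutive blocks partition \<open>{0<..1}\<close>.\<close>
definition bint :: "real \<Rightarrow> real \<Rightarrow> (real \<Rightarrow> complex) set" where
  "bint b c = {f. (\<forall>u v. f integrable_on {u..v}) \<and> bounded (range f) \<and> (\<forall>x. x \<notin> {b<..c} \<longrightarrow> f x = 0)}"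

lemma bint_bounded:
  assumes "f \<in> bint b c"
  obtains C where "C \<ge> 0" "\<And>x. norm (f x) \<le> C"
proof -
  obtain C where "\<And>x. norm (f x) \<le> C" using assms by (auto simp: bint_def bounded_iff)
  then show ?thesis using that norm_ge_zero order_trans by metis
qed

lemma bintI:
  assumes "\<And>u v. f integrable_on {u..v}" "\<And>x. norm (f x) \<le> C" "\<And>x. x \<notin> {b<..c} \<Longrightarrow> f x = 0"
  shows "f \<in> bint b c"
  using assms by (auto simp: bint_def bounded_iff)

lemma bint_integrable: "f \<in> bint b c \<Longrightarrow> f integrable_on {u..v}"
  and bint_outside: "f \<in> bint b c \<Longrightarrow> x \<notin> {b<..c} \<Longrightarrow> f x = 0"
  by (auto simp: bint_def)

lemma subspace_bint: "cfun.subspace (bint b c)"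
proof (rule cfun.subspaceI)
  show "0 \<in> bint b c" by (rule bintI[where C=0]) (auto simp: zero_fun_def)
next
  fix f g assume fg: "f \<in> bint b c" "g \<in> bint b c"
  obtain C where C: "\<And>x. norm (f x) \<le> C" using fg bint_bounded by metis
  obtain D where D: "\<And>x. norm (g x) \<le> D" using fg bint_bounded by metis
  have n: "norm (f x + g x) \<le> C + D" for x using norm_triangle_ineq[of "f x" "g x"] C[of x] D[of x] by linarith
  show "f + g \<in> bint b c"
    by (rule bintI[where C="C + D"])
      (auto simp: plus_fun_def n bint_integrable[OF fg(1)] bint_integrable[OF fg(2)]
        intro!: integrable_add, auto simp: bint_outside[OF fg(1)] bint_outside[OF fg(2)])
next
  fix k f assume f: "f \<in> bint b c"
  obtain C where C: "\<And>x. norm (f x) \<le> C" using f bint_bounded by metis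
  show "fscale k f \<in> bint b c"
    by (rule bintI[where C="norm k * C"])
      (auto simp: fscale_def norm_mult bint_outside[OF f] C mult_left_mono
        intro!: integrable_on_mult_right bint_integrable[OF f])
qed

lemma bint_restrict_continuous:
  assumes "continuous_on {b..c} h"
  shows "(\<lambda>x. if x \<in> {b<..c} then h x else 0) \<in> bint b c"
proof -
  obtain C where C: "\<And>x. x \<in> {b..c} \<Longrightarrow> norm (h x) \<le> C"
    using compact_imp_bounded[OF compact_continuous_image[OF assms compact_Icc]]
    unfolding bounded_iff by blast
  show ?thesis
  proof (rule bintI[where C="max C 0"])
    fix u v
    have "h integrable_on {b..c} \<inter> {u..v}"
      using integrable_continuous_interval[OF continuous_on_subset[OF assms]] by simp
    then have "(\<lambda>x. if x \<in> {b..c} then h x else 0) integrable_on {u..v}"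
      by (simp only: integrable_restrict_Int)
    then show "(\<lambda>x. if x \<in> {b<..c} then h x else 0) integrable_on {u..v}"
      by (rule integrable_spike[where S="{b}"]) auto
    show "norm (if x \<in> {b<..c} then h x else 0) \<le> max C 0" for x
      using C[of x] by auto
  qed auto
qed

lemma bint_integral_bound:
  assumes "f \<in> bint b c" "\<And>x. norm (f x) \<le> C" "u \<le> v"
  shows "norm (integral {u..v} f) \<le> C * (v - u)"
proof -
  have "norm (integral (cbox u v) f) \<le> C * Henstock_Kurzweil_Integration.content (cbox u v)"
    using order_trans[OF norm_ge_zero assms(2)] assms(2) bint_integrable[OF assms(1)]
    by (intro integrable_bound) auto
  then show ?thesis using assms(3) by (simp add: content_real)
qed

lemma linear_on_id_minus:
  assumes L: "cfun.linear_on (bint b c) L"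
  shows "cfun.linear_on (bint b c) (\<lambda>g. g - fscale z (L g))"
proof -
  note hom = cfun.linear_onD(2)[OF L]
  have "g - fscale z (L g) \<in> bint b c" if "g \<in> bint b c" for g
    using cfun.linear_onD(3)[OF L that] that
    by (intro cfun.subspace_diff[OF subspace_bint] cfun.subspace_scale[OF subspace_bint])
  then show ?thesis
    unfolding cfun.linear_on_def[of _ "\<lambda>g. g - fscale z (L g)"]
    using subspace_bint
    by (auto simp: cfun.hom_on_def cfun.hom_on_add[OF hom] cfun.hom_on_scale[OF hom] fun_eq_iff algebra_simps)
qed

section \<open>Neumann series of operators with factorially decaying powers\<close>

text \<open>The bound on the powers is the classical estimate for iterated integrals. It makes the
  spectral radius zero, so the Neumann series converges for every parameter.\<close>

definition volterra :: "real \<Rightarrow> real \<Rightarrow> ((real \<Rightarrow> complex) \<Rightarrow> real \<Rightarrow> complex) \<Rightarrow> real \<Rightarrow> bool" where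
  "volterra b c L B \<longleftrightarrow> cfun.linear_on (bint b c) L \<and> B \<ge> 0 \<and>
     (\<forall>f\<in>bint b c. \<forall>C. (\<forall>x. norm (f x) \<le> C) \<longrightarrow> (\<forall>n x. norm ((L ^^ n) f x) \<le> C * B ^ n / fact n))"

text \<open>The inverse of \<open>1 - z L\<close> on \<open>bint b c\<close>, as
  \<open>neumann_eq\<close> and \<open>neumann_unique\<close> confirm.\<close>

definition neumann :: "((real \<Rightarrow> complex) \<Rightarrow> real \<Rightarrow> complex) \<Rightarrow> complex \<Rightarrow> (real \<Rightarrow> complex) \<Rightarrow> real \<Rightarrow> complex" where
  "neumann L z f = (\<lambda>x. \<Sum>n. z ^ n * (L ^^ n) f x)"

lemma exp_sums_norm: "(\<lambda>n. C * (r ^ n * B ^ n / fact n)) sums (C * exp (r * B))" for r B C :: real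
  using exp_converges[of "r * B"]
  by (intro sums_mult) (simp add: power_mult_distrib scaleR_conv_of_real field_simps)

context
  fixes b c B :: real and L :: "(real \<Rightarrow> complex) \<Rightarrow> real \<Rightarrow> complex"
  assumes volt: "volterra b c L B"
begin

lemma volterra_lin: "cfun.linear_on (bint b c) L"
  using volt by (simp add: volterra_def)

lemma volterra_funpow_in: "f \<in> bint b c \<Longrightarrow> (L ^^ n) f \<in> bint b c"
  using cfun.linear_onD(3)[OF cfun.linear_on_funpow[OF volterra_lin]] .

lemma volterra_term_bound:
  assumes "f \<in> bint b c" "\<And>x. norm (f x) \<le> C"
  shows "norm (z ^ n * (L ^^ n) f x) \<le> C * (norm z ^ n * B ^ n / fact n)"
proof -
  have "norm ((L ^^ n) f x) \<le> C * B ^ n / fact n"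
    using volt assms by (auto simp: volterra_def)
  then have "norm z ^ n * norm ((L ^^ n) f x) \<le> norm z ^ n * (C * B ^ n / fact n)"
    by (intro mult_left_mono) auto
  then show ?thesis by (simp add: norm_mult norm_power algebra_simps)
qed

lemma neumann_sums:
  assumes "f \<in> bint b c"
  shows "(\<lambda>n. z ^ n * (L ^^ n) f x) sums neumann L z f x"
proof -
  obtain C where C: "\<And>x. norm (f x) \<le> C" using assms bint_bounded by metis
  have "summable (\<lambda>n. z ^ n * (L ^^ n) f x)"
    using volterra_term_bound[OF assms C]
    by (intro summable_comparison_test'[OF sums_summable[OF exp_sums_norm[of C "norm z" B]], of 0]) auto
  then show ?thesis by (simp add: neumann_def summable_sums)
qed

definition "neumann_part z N f = (\<Sum>n<N. fscale (z ^ n) ((L ^^ n) f))"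

lemma neumann_part_in: "f \<in> bint b c \<Longrightarrow> neumann_part z N f \<in> bint b c"
  unfolding neumann_part_def
  by (intro cfun.subspace_sum[OF subspace_bint] cfun.subspace_scale[OF subspace_bint] volterra_funpow_in)

text \<open>The tail is majorized by the tail of an exponential series. This majorant does not
  depend on \<open>x\<close>, so the convergence is uniform.\<close>

lemma neumann_tail:
  assumes "f \<in> bint b c" "\<And>x. norm (f x) \<le> C"
  shows "norm (neumann L z f x - neumann_part z N f x) \<le>
    C * exp (norm z * B) - (\<Sum>n<N. C * (norm z ^ n * B ^ n / fact n))"
proof -
  have "(\<lambda>n. z ^ (n + N) * (L ^^ (n + N)) f x) sums (neumann L z f x - neumann_part z N f x)"
    using sums_split_initial_segment[OF neumann_sums[OF assms(1), of z x], of N]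
    by (simp add: neumann_part_def sum_fun_apply)
  moreover note sums_split_initial_segment[OF exp_sums_norm[of C "norm z" B], of N]
  ultimately show ?thesis
    by (rule norm_sums_le) (rule volterra_term_bound[OF assms])
qed

lemma neumann_tail_null:
  "(\<lambda>N. C * exp (r * B) - (\<Sum>n<N. C * (r ^ n * B ^ n / fact n))) \<longlonglongrightarrow> 0"
  using tendsto_diff[OF tendsto_const exp_sums_norm[of C r B, unfolded sums_def], of "C * exp (r * B)"] by simp

lemma neumann_bound:
  assumes "f \<in> bint b c" "\<And>x. norm (f x) \<le> C"
  shows "norm (neumann L z f x) \<le> C * exp (norm z * B)"
  using neumann_tail[OF assms, where N=0] by (simp add: neumann_part_def)

text \<open>Integrability passes to the limit because the partial sums converge uniformly.\<close>

lemma neumann_in: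
  assumes f: "f \<in> bint b c"
  shows "neumann L z f \<in> bint b c"
proof -
  obtain C where C: "\<And>x. norm (f x) \<le> C" using assms bint_bounded by metis
  show ?thesis
  proof (rule bintI)
    fix u v
    have "neumann L z f integrable_on cbox u v"
    proof (rule integrable_uniform_limit)
      fix e :: real assume "e > 0"
      from order_tendstoD(2)[OF neumann_tail_null[of C "norm z"] this]
      obtain N where "C * exp (norm z * B) - (\<Sum>n<N. C * (norm z ^ n * B ^ n / fact n)) < e"
        by (auto simp: eventually_sequentially)
      then have "\<forall>x. norm (neumann L z f x - neumann_part z N f x) \<le> e"
        using neumann_tail[OF f C, of z _ N] by (meson less_imp_le order_trans)
      moreover have "neumann_part z N f integrable_on cbox u v"
        using bint_integrable[OF neumann_part_in[OF f]] by simp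
      ultimately show "\<exists>g. (\<forall>x\<in>cbox u v. norm (neumann L z f x - g x) \<le> e) \<and> g integrable_on cbox u v"
        by blast
    qed
    then show "neumann L z f integrable_on {u..v}" by simp
    show "norm (neumann L z f x) \<le> C * exp (norm z * B)" for x
      by (rule neumann_bound[OF f C])
    show "neumann L z f x = 0" if "x \<notin> {b<..c}" for x
      using bint_outside[OF volterra_funpow_in[OF f] that] by (simp add: neumann_def)
  qed
qed

text \<open>A linear functional bounded in the supremum norm may be applied term by term to a
  uniformly convergent series. It is used for the value of \<open>L g\<close> at a point and for the
  integral over a block.\<close>

lemma neumann_functional_sums:
  fixes F :: "(real \<Rightarrow> complex) \<Rightarrow> complex"
  assumes f: "f \<in> bint b c"
    and add: "\<And>f g. f \<in> bint b c \<Longrightarrow> g \<in> bint b c \<Longrightarrow> F (f + g) = F f + F g"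
    and scl: "\<And>k f. f \<in> bint b c \<Longrightarrow> F (fscale k f) = k * F f"
    and bd: "\<And>f C. f \<in> bint b c \<Longrightarrow> (\<And>x. norm (f x) \<le> C) \<Longrightarrow> norm (F f) \<le> K * C"
  shows "(\<lambda>n. z ^ n * F ((L ^^ n) f)) sums F (neumann L z f)"
proof -
  obtain C where C: "\<And>x. norm (f x) \<le> C" using assms bint_bounded by metis
  have F0: "F 0 = 0" using scl[OF cfun.subspace_0[OF subspace_bint], of 0] by simp
  have part: "F (neumann_part z N f) = (\<Sum>n<N. z ^ n * F ((L ^^ n) f))" for N
  proof (induction N)
    case (Suc N)
    have "neumann_part z (Suc N) f = neumann_part z N f + fscale (z ^ N) ((L ^^ N) f)"
      by (simp add: neumann_part_def)
    then have "F (neumann_part z (Suc N) f) = F (neumann_part z N f) + z ^ N * F ((L ^^ N) f)"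
      using add[OF neumann_part_in[OF f] cfun.subspace_scale[OF subspace_bint volterra_funpow_in[OF f]]]
        scl[OF volterra_funpow_in[OF f]] by metis
    then show ?case using Suc by simp
  next
    case 0
    have "neumann_part z 0 f = 0" by (simp add: neumann_part_def)
    then show ?case using F0 by (metis lessThan_0 sum.empty)
  qed
  have "norm (F (neumann L z f) - (\<Sum>n<N. z ^ n * F ((L ^^ n) f)))
      \<le> K * (C * exp (norm z * B) - (\<Sum>n<N. C * (norm z ^ n * B ^ n / fact n)))" for N
  proof -
    let ?d = "neumann L z f - neumann_part z N f"
    have d: "?d \<in> bint b c"
      using neumann_in neumann_part_in f by (intro cfun.subspace_diff[OF subspace_bint])
    have "F (neumann L z f) = F ?d + F (neumann_part z N f)"
      using add[OF d neumann_part_in[OF f, of z N]] by simp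
    then have "F (neumann L z f) - (\<Sum>n<N. z ^ n * F ((L ^^ n) f)) = F ?d"
      by (simp add: part)
    then show ?thesis using bd[OF d] neumann_tail[OF f C, of z _ N] by simp
  qed
  then have "(\<lambda>N. norm (F (neumann L z f) - (\<Sum>n<N. z ^ n * F ((L ^^ n) f)))) \<longlonglongrightarrow> 0"
    by (intro tendsto_sandwich[OF _ _ tendsto_const tendsto_mult_right_zero[OF neumann_tail_null]])
      (auto intro!: always_eventually)
  then have "(\<lambda>N. F (neumann L z f) - (\<Sum>n<N. z ^ n * F ((L ^^ n) f))) \<longlonglongrightarrow> 0"
    by (rule tendsto_norm_zero_cancel)
  from tendsto_diff[OF tendsto_const this, of "F (neumann L z f)"]
  show ?thesis by (simp add: sums_def)
qed

text \<open>Applying \<open>z L\<close> term by term shifts the index, so only the term of index 0,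
  which is \<open>f\<close>, survives in the difference.\<close>

lemma neumann_eq:
  assumes f: "f \<in> bint b c"
  shows "neumann L z f - fscale z (L (neumann L z f)) = f"
proof
  fix x
  note hom = cfun.linear_onD(2)[OF volterra_lin]
  have "norm (L g x) \<le> B * C" if "g \<in> bint b c" "\<And>x. norm (g x) \<le> C" for g C
  proof -
    have "norm ((L ^^ 1) g x) \<le> C * B ^ 1 / fact 1"
      using volt that unfolding volterra_def by blast
    then show ?thesis by (simp add: mult.commute)
  qed
  then have "(\<lambda>n. z ^ n * L ((L ^^ n) f) x) sums L (neumann L z f) x"
    using cfun.hom_on_add[OF hom] cfun.hom_on_scale[OF hom]
    by (intro neumann_functional_sums[OF f, where F="\<lambda>g. L g x" and K=B]) auto
  then have "(\<lambda>n. z * (z ^ n * L ((L ^^ n) f) x)) sums (z * L (neumann L z f) x)"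
    by (rule sums_mult)
  then have "(\<lambda>n. z ^ Suc n * (L ^^ Suc n) f x) sums (z * L (neumann L z f) x)"
    by (simp add: mult.assoc)
  then have "(\<lambda>n. z ^ n * (L ^^ n) f x) sums (z * L (neumann L z f) x + f x)"
    by (subst (asm) sums_Suc_iff) simp
  then have "neumann L z f x = z * L (neumann L z f) x + f x"
    using neumann_sums[OF f] sums_unique2 by blast
  then show "(neumann L z f - fscale z (L (neumann L z f))) x = f x" by simp
qed

text \<open>Iterating the equation gives \<open>g = z^n L^n g\<close> for all \<open>n\<close>, and
  the factorial bound forces the right side to 0.\<close>

lemma volterra_kernel:
  assumes g: "g \<in> bint b c" "g = fscale z (L g)"
  shows "g = 0"
proof
  fix x
  obtain C where C: "\<And>x. norm (g x) \<le> C" using g bint_bounded by metis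
  have "g = fscale (z ^ n) ((L ^^ n) g)" for n
  proof (induction n)
    case (Suc n)
    have "g = fscale z (L (fscale (z ^ n) ((L ^^ n) g)))" using g(2) Suc by metis
    also have "\<dots> = fscale (z ^ Suc n) ((L ^^ Suc n) g)"
      using cfun.hom_on_scale[OF cfun.linear_onD(2)[OF volterra_lin] volterra_funpow_in[OF g(1)]]
      by (simp add: fun_eq_iff)
    finally show ?case .
  qed (simp add: fun_eq_iff)
  then have "norm (g x) \<le> C * (norm z ^ n * B ^ n / fact n)" for n
    using volterra_term_bound[OF g(1) C, of z n x] by (metis fscale_apply)
  moreover have "(\<lambda>n. C * (norm z ^ n * B ^ n / fact n)) \<longlonglongrightarrow> 0"
    using summable_LIMSEQ_zero[OF sums_summable[OF exp_sums_norm]] .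
  ultimately have "norm (g x) \<le> 0"
    by (meson LIMSEQ_le_const)
  then show "g x = 0 x" by simp
qed

text \<open>A right inverse of an injective linear map is also a left inverse.\<close>

lemma neumann_unique:
  assumes "g \<in> bint b c"
  shows "neumann L z (g - fscale z (L g)) = g"
proof -
  let ?T = "\<lambda>g. g - fscale z (L g)"
  let ?h = "neumann L z (?T g)"
  have h: "?h \<in> bint b c" by (intro neumann_in cfun.linear_onD(3)[OF linear_on_id_minus[OF volterra_lin]] assms)
  have "?T (?h - g) = ?T ?h - ?T g"
    by (rule cfun.hom_on_diff[OF cfun.linear_onD(1,2)[OF linear_on_id_minus[OF volterra_lin]] h assms])
  also have "?T ?h = ?T g"
    by (intro neumann_eq cfun.linear_onD(3)[OF linear_on_id_minus[OF volterra_lin]] assms)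
  finally have "?T (?h - g) = 0" by (simp only: diff_self)
  then have "?h - g = fscale z (L (?h - g))" by (simp only: right_minus_eq)
  then have "?h - g = 0"
    by (intro volterra_kernel[of _ z] cfun.subspace_diff[OF subspace_bint] h assms)
  then show ?thesis by simp
qed

lemma linear_on_neumann: "cfun.linear_on (bint b c) (neumann L z)"
proof -
  let ?T = "\<lambda>g. g - fscale z (L g)"
  note hom = cfun.linear_onD(2)[OF linear_on_id_minus[OF volterra_lin, of z]]
  note sub = subspace_bint[of b c]
  have "neumann L z (f + g) = neumann L z f + neumann L z g" if fg: "f \<in> bint b c" "g \<in> bint b c" for f g
  proof -
    have "?T (neumann L z f + neumann L z g) = f + g"
      using cfun.hom_on_add[OF hom neumann_in[OF fg(1)] neumann_in[OF fg(2)]]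
      by (simp only: neumann_eq[OF fg(1)] neumann_eq[OF fg(2)])
    then show ?thesis
      using neumann_unique[OF cfun.subspace_add[OF sub neumann_in[OF fg(1), of z] neumann_in[OF fg(2), of z]], of z]
      by (simp only:)
  qed
  moreover have "neumann L z (fscale k f) = fscale k (neumann L z f)" if f: "f \<in> bint b c" for f k
  proof -
    have "?T (fscale k (neumann L z f)) = fscale k f"
      using cfun.hom_on_scale[OF hom neumann_in[OF f]] by (simp only: neumann_eq[OF f])
    then show ?thesis
      using neumann_unique[OF cfun.subspace_scale[OF sub neumann_in[OF f, of z]], of z k]
      by (simp only:)
  qed
  ultimately show ?thesis
    using sub neumann_in by (auto simp: cfun.linear_on_def cfun.hom_on_def)
qed

lemma riesz_id_minus_volterra: "cfun.riesz (bint b c) (\<lambda>g. g - fscale z (L g)) 0"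
proof (rule cfun.riesz_bij[OF linear_on_id_minus[OF volterra_lin]])
  show "x = 0" if "x \<in> bint b c" "x - fscale z (L x) = 0" for x
    using volterra_kernel[of x z] that by simp
  show "\<exists>y\<in>bint b c. x = y - fscale z (L y)" if "x \<in> bint b c" for x
    using neumann_eq[OF that, of z] neumann_in[OF that] by metis
qed

end

section \<open>The blocks of the operator\<close>

text \<open>The compression of the operator to \<open>{b<..c}\<close>. The integral starts at
  \<open>b\<close> since the functions concerned vanish to the left; the block from 0 to 1 is the
  whole operator except at the point 0.\<close>

definition Vblock :: "(real \<Rightarrow> real) \<Rightarrow> real \<Rightarrow> real \<Rightarrow> (real \<Rightarrow> complex) \<Rightarrow> real \<Rightarrow> complex" where
  "Vblock \<phi> b c f = (\<lambda>x. if x \<in> {b<..c} then integral {b..\<phi> x} f else 0)"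

definition Kblock :: "(real \<Rightarrow> real) \<Rightarrow> real \<Rightarrow> real \<Rightarrow> (real \<Rightarrow> complex) \<Rightarrow> real \<Rightarrow> complex" where
  "Kblock \<phi> b c f = (\<lambda>x. if x \<in> {b<..c} then integral {\<phi> x..c} f else 0)"

definition unit_block :: "real \<Rightarrow> real \<Rightarrow> real \<Rightarrow> complex" where
  "unit_block b c = (\<lambda>x. if x \<in> {b<..c} then 1 else 0)"

lemma unit_block_in: "unit_block b c \<in> bint b c"
  unfolding unit_block_def by (intro bint_restrict_continuous continuous_intros)

text \<open>The weight \<open>s x\<close> will be the distance from \<open>x\<close> to an endpoint
  of the block. One application of \<open>L\<close> turns the profile \<open>s^n / n!\<close> into
  the next one, so iteration yields the factorial bound.\<close>

lemma volterraI:
  assumes lin: "cfun.linear_on (bint b c) L"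
    and s: "\<And>x. x \<in> {b<..c} \<Longrightarrow> 0 \<le> s x" "\<And>x. x \<in> {b<..c} \<Longrightarrow> s x \<le> B" and B: "B \<ge> 0"
    and step: "\<And>f n C x. f \<in> bint b c \<Longrightarrow> C \<ge> 0 \<Longrightarrow> (\<And>x. x \<in> {b<..c} \<Longrightarrow> norm (f x) \<le> C * s x ^ n / fact n)
      \<Longrightarrow> x \<in> {b<..c} \<Longrightarrow> norm (L f x) \<le> C * s x ^ Suc n / fact (Suc n)"
  shows "volterra b c L B"
proof -
  have "norm ((L ^^ n) f x) \<le> C * B ^ n / fact n"
    if f: "f \<in> bint b c" and C: "\<forall>x. norm (f x) \<le> C" for f C n x
  proof -
    have C0: "C \<ge> 0" using C norm_ge_zero order_trans by blast
    have Ln: "(L ^^ n) f \<in> bint b c" for n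
      using cfun.linear_onD(3)[OF cfun.linear_on_funpow[OF lin] f] .
    show ?thesis
    proof (cases "x \<in> {b<..c}")
      case True
      have "norm ((L ^^ n) f x) \<le> C * s x ^ n / fact n" if "x \<in> {b<..c}" for x
        using that
      proof (induction n arbitrary: x)
        case (Suc n)
        then show ?case using step[OF Ln[of n] C0] by simp
      qed (use C in simp)
      also have "C * s x ^ n / fact n \<le> C * B ^ n / fact n"
        using s True C0 by (intro divide_right_mono mult_left_mono power_mono) auto
      finally show ?thesis using True by simp
    next
      case False
      then show ?thesis using bint_outside[OF Ln] C0 B by simp
    qed
  qed
  then show ?thesis using lin B by (auto simp: volterra_def)
qed

context
  fixes b c :: real and \<phi> :: "real \<Rightarrow> real"
  assumes bc: "b \<le> c" and cont: "continuous_on {b..c} \<phi>" and maps: "\<phi> ` {b..c} \<subseteq> {b..c}"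
begin

lemma phi_in: "x \<in> {b<..c} \<Longrightarrow> \<phi> x \<in> {b..c}"
  using maps by (auto simp: image_subset_iff)

lemma linear_on_Vblock: "cfun.linear_on (bint b c) (Vblock \<phi> b c)"
proof -
  have "Vblock \<phi> b c f \<in> bint b c" if f: "f \<in> bint b c" for f
    unfolding Vblock_def
    by (intro bint_restrict_continuous
        continuous_on_compose2[OF indefinite_integral_continuous_1[OF bint_integrable[OF f]] cont maps])
  then show ?thesis
    using subspace_bint
    by (auto simp: cfun.linear_on_def cfun.hom_on_def Vblock_def fun_eq_iff plus_fun_def fscale_def
        integral_add bint_integrable)
qed

lemma linear_on_Kblock: "cfun.linear_on (bint b c) (Kblock \<phi> b c)"
proof -
  have "Kblock \<phi> b c f \<in> bint b c" if f: "f \<in> bint b c" for f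
    unfolding Kblock_def
    by (intro bint_restrict_continuous
        continuous_on_compose2[OF indefinite_integral_continuous_1'[OF bint_integrable[OF f]] cont maps])
  then show ?thesis
    using subspace_bint
    by (auto simp: cfun.linear_on_def cfun.hom_on_def Kblock_def fun_eq_iff plus_fun_def fscale_def
        integral_add bint_integrable)
qed

text \<open>The integral over the block is cut at \<open>\<phi> x\<close>. This displays the block
  as a rank one operator minus \<open>Kblock\<close>.\<close>

lemma Vblock_eq_Kblock:
  assumes "f \<in> bint b c"
  shows "Vblock \<phi> b c f = fscale (integral {b..c} f) (unit_block b c) - Kblock \<phi> b c f"
proof
  fix x
  show "Vblock \<phi> b c f x = (fscale (integral {b..c} f) (unit_block b c) - Kblock \<phi> b c f) x"
    using Henstock_Kurzweil_Integration.integral_combine[of b "\<phi> x" c f] phi_in[of x] bint_integrable[OF assms]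
    by (auto simp: Vblock_def Kblock_def unit_block_def algebra_simps)
qed

text \<open>Integrating \<open>(t - b)^n / n!\<close> up to \<open>\<phi> x\<close> gives the next
  profile at \<open>\<phi> x\<close>, which is at most its value at \<open>x\<close> because
  \<open>\<phi> x \<le> x\<close>.\<close>

lemma volterra_Vblock:
  assumes "\<And>x. x \<in> {b<..c} \<Longrightarrow> \<phi> x \<le> x"
  shows "volterra b c (Vblock \<phi> b c) (c - b)"
proof (rule volterraI[where s="\<lambda>x. x - b", OF linear_on_Vblock])
  fix f n x and C :: real
  assume f: "f \<in> bint b c" and C: "C \<ge> 0" and x: "x \<in> {b<..c}"
    and bd: "\<And>x. x \<in> {b<..c} \<Longrightarrow> norm (f x) \<le> C * (x - b) ^ n / fact n"
  have I: "((\<lambda>t. C * (t - b) ^ n / fact n) has_integral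
      C * (\<phi> x - b) ^ Suc n / fact (Suc n) - C * (b - b) ^ Suc n / fact (Suc n)) {b..\<phi> x}"
  proof (rule fundamental_theorem_of_calculus)
    show "((\<lambda>t. C * (t - b) ^ Suc n / fact (Suc n)) has_vector_derivative C * (t - b) ^ n / fact n)
        (at t within {b..\<phi> x})" for t
      unfolding has_real_derivative_iff_has_vector_derivative[symmetric]
      by (rule derivative_eq_intros refl | simp)+
  qed (use phi_in[OF x] in auto)
  have "norm (f t) \<le> C * (t - b) ^ n / fact n" if "t \<in> {b..\<phi> x}" for t
  proof (cases "t = b")
    case True
    then show ?thesis using bint_outside[OF f, of b] C by simp
  qed (use bd[of t] that phi_in[OF x] in auto)
  then have "norm (integral {b..\<phi> x} f) \<le> integral {b..\<phi> x} (\<lambda>t. C * (t - b) ^ n / fact n)"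
    using I bint_integrable[OF f] by (intro integral_norm_bound_integral) auto
  also have "\<dots> = C * (\<phi> x - b) ^ Suc n / fact (Suc n)"
    using integral_unique[OF I] by simp
  also have "\<dots> \<le> C * (x - b) ^ Suc n / fact (Suc n)"
    using C x phi_in[OF x] assms[OF x] by (intro divide_right_mono mult_left_mono power_mono) auto
  finally show "norm (Vblock \<phi> b c f x) \<le> C * (x - b) ^ Suc n / fact (Suc n)"
    using x by (simp add: Vblock_def)
qed (use bc in auto)

lemma volterra_Kblock:
  assumes "\<And>x. x \<in> {b<..c} \<Longrightarrow> x \<le> \<phi> x"
  shows "volterra b c (Kblock \<phi> b c) (c - b)"
proof (rule volterraI[where s="\<lambda>x. c - x", OF linear_on_Kblock])
  fix f n x and C :: real
  assume f: "f \<in> bint b c" and C: "C \<ge> 0" and x: "x \<in> {b<..c}"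
    and bd: "\<And>x. x \<in> {b<..c} \<Longrightarrow> norm (f x) \<le> C * (c - x) ^ n / fact n"
  have I: "((\<lambda>t. C * (c - t) ^ n / fact n) has_integral
      - C * (c - c) ^ Suc n / fact (Suc n) - - C * (c - \<phi> x) ^ Suc n / fact (Suc n)) {\<phi> x..c}"
  proof (rule fundamental_theorem_of_calculus)
    show "((\<lambda>t. - C * (c - t) ^ Suc n / fact (Suc n)) has_vector_derivative C * (c - t) ^ n / fact n)
        (at t within {\<phi> x..c})" for t
      unfolding has_real_derivative_iff_has_vector_derivative[symmetric]
      by (rule derivative_eq_intros refl | simp)+
  qed (use phi_in[OF x] in auto)
  have "norm (f t) \<le> C * (c - t) ^ n / fact n" if "t \<in> {\<phi> x..c}" for t
    using bd[of t] that x assms[OF x] by auto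
  then have "norm (integral {\<phi> x..c} f) \<le> integral {\<phi> x..c} (\<lambda>t. C * (c - t) ^ n / fact n)"
    using I bint_integrable[OF f] by (intro integral_norm_bound_integral) auto
  also have "\<dots> = C * (c - \<phi> x) ^ Suc n / fact (Suc n)"
    using integral_unique[OF I] by simp
  also have "\<dots> \<le> C * (c - x) ^ Suc n / fact (Suc n)"
    using C x phi_in[OF x] assms[OF x] by (intro divide_right_mono mult_left_mono power_mono) auto
  finally show "norm (Kblock \<phi> b c f x) \<le> C * (c - x) ^ Suc n / fact (Suc n)"
    using x by (simp add: Kblock_def)
qed (use bc in auto)

end

section \<open>Vanishing order read off from an expansion with remainder\<close>

lemma tendsto_bounded_mult_null:
  fixes w r :: "'a \<Rightarrow> complex"
  assumes "(w \<longlongrightarrow> 0) F" "\<forall>\<^sub>F z in F. norm (r z) \<le> C"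
  shows "((\<lambda>z. w z * r z) \<longlongrightarrow> 0) F"
proof (rule tendsto_0_le[where K=C])
  show "(w \<longlongrightarrow> 0) F" by fact
  show "\<forall>\<^sub>F z in F. norm (w z * r z) \<le> norm (w z) * C"
    using assms(2) by eventually_elim (simp add: norm_mult mult_left_mono)
qed

text \<open>Uniqueness of expansion coefficients in the small quantity \<open>w\<close>: taking
  limits determines the constant coefficient, division by \<open>w\<close> lowers the order, and the
  argument repeats.\<close>

lemma expansion_leading_coeff:
  fixes w g r :: "'a \<Rightarrow> complex" and d :: "nat \<Rightarrow> complex"
  assumes "F \<noteq> bot" "(w \<longlongrightarrow> 0) F" "\<forall>\<^sub>F z in F. w z \<noteq> 0" "(g \<longlongrightarrow> g0) F"
    and "\<forall>\<^sub>F z in F. norm (r z) \<le> C"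
    and "\<forall>\<^sub>F z in F. w z ^ m * g z = (\<Sum>k\<le>m. d k * w z ^ k) + w z ^ Suc m * r z"
  shows "(\<forall>k<m. d k = 0) \<and> d m = g0"
  using assms(6)
proof (induction m arbitrary: d)
  case 0
  then have "\<forall>\<^sub>F z in F. g z = d 0 + w z * r z" by simp
  then have "(g \<longlongrightarrow> d 0 + 0) F"
    by (intro Lim_transform_eventually[OF tendsto_add[OF tendsto_const tendsto_bounded_mult_null[OF assms(2,5)]]])
      (auto elim: eventually_mono)
  then show ?case using assms(1,4) tendsto_unique by force
next
  case (Suc m)
  let ?q = "\<lambda>z. (\<Sum>k\<le>m. d (Suc k) * w z ^ k) + w z ^ Suc m * r z"
  have ev: "\<forall>\<^sub>F z in F. w z ^ Suc m * g z = d 0 + w z * ?q z"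
    using Suc.prems
    by eventually_elim (simp add: sum.atMost_Suc_shift sum_distrib_left algebra_simps del: sum.atMost_Suc)
  have wS: "((\<lambda>z. w z ^ Suc m) \<longlongrightarrow> 0) F"
    using tendsto_power[OF assms(2), of "Suc m"] by simp
  have "(?q \<longlongrightarrow> (\<Sum>k\<le>m. d (Suc k) * 0 ^ k) + 0) F"
    by (rule tendsto_add[OF tendsto_sum tendsto_bounded_mult_null[OF wS assms(5)]])
      (intro tendsto_intros assms(2))
  then have "((\<lambda>z. d 0 + w z * ?q z) \<longlongrightarrow> d 0 + 0 * ((\<Sum>k\<le>m. d (Suc k) * 0 ^ k) + 0)) F"
    by (rule tendsto_add[OF tendsto_const tendsto_mult[OF assms(2)]])
  then have "((\<lambda>z. w z ^ Suc m * g z) \<longlongrightarrow> d 0) F"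
    using tendsto_cong[OF ev] by simp
  moreover have "((\<lambda>z. w z ^ Suc m * g z) \<longlongrightarrow> 0 * g0) F"
    by (intro tendsto_mult wS assms(4))
  ultimately have d0: "d 0 = 0" using tendsto_unique[OF assms(1)] by fastforce
  have "\<forall>\<^sub>F z in F. w z ^ m * g z = ?q z"
    using ev assms(3) by eventually_elim (simp add: d0)
  then have "(\<forall>k<m. d (Suc k) = 0) \<and> d (Suc m) = g0"
    using Suc.IH[of "d \<circ> Suc"] by simp
  then show ?case using d0 by (auto simp: less_Suc_eq_0_disj)
qed

section \<open>Blocks on which the map lies above the diagonal\<close>

context
  fixes b c :: real and \<phi> p :: "real \<Rightarrow> real"
  assumes bc: "b < c" and cont: "continuous_on {b..c} \<phi>" and maps: "\<phi> ` {b..c} \<subseteq> {b..c}"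
    and above: "\<And>x. x \<in> {b<..c} \<Longrightarrow> x \<le> \<phi> x"
    and p: "\<And>s. p s = (\<phi> (s * (c - b) + b) - b) / (c - b)"
begin

text \<open>The affine substitution carrying the block to the unit interval turns the iterates of
  \<open>Kblock\<close> on the unit function into the nested integrals; every integration
  contributes a factor \<open>c - b\<close>.\<close>

lemma Kblock_funpow_unit:
  assumes "x \<in> {b<..c}"
  shows "(Kblock \<phi> b c ^^ n) (unit_block b c) x = of_real ((c - b) ^ n * nest p n ((x - b) / (c - b)))"
  using assms
proof (induction n arbitrary: x)
  case 0
  then show ?case by (simp add: unit_block_def)
next
  case (Suc n)
  let ?f = "(Kblock \<phi> b c ^^ n) (unit_block b c)"
  let ?I = "integral {\<phi> x..c} ?f"
  have volt: "volterra b c (Kblock \<phi> b c) (c - b)"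
    using volterra_Kblock[OF _ cont maps above] bc by simp
  have "(?f has_integral ?I) {\<phi> x..c}"
    using bint_integrable[OF volterra_funpow_in[OF volt unit_block_in]] by blast
  moreover have "?f t = of_real ((c - b) ^ n * nest p n ((t - b) / (c - b)))" if "t \<in> {\<phi> x..c}" for t
    using Suc.IH[of t] that Suc.prems above[OF Suc.prems] by auto
  ultimately have I: "((\<lambda>t. complex_of_real ((c - b) ^ n * nest p n ((t - b) / (c - b)))) has_integral ?I) {\<phi> x..c}"
    using has_integral_eq by (metis (mono_tags, lifting))
  \<comment> \<open>The integrand takes real values, so the imaginary part of the integral vanishes
    and the real part can be compared with \<open>nest\<close>.\<close>
  have "((\<lambda>t. 0::real) has_integral Im ?I) {\<phi> x..c}"
    using has_integral_Im[OF I] by simp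
  then have Im: "Im ?I = 0" by (simp add: has_integral_iff)
  have "((\<lambda>t. (c - b) ^ n * nest p n ((t - b) / (c - b))) has_integral Re ?I) (cbox (\<phi> x) c)"
    using has_integral_Re[OF I] by simp
  from has_integral_affinity'[OF this, of "c - b" b]
  have "((\<lambda>s. (c - b) ^ n * nest p n s) has_integral Re ?I / (c - b)) {(\<phi> x - b) / (c - b)..1}"
    using bc by (simp add: divide_inverse_commute[symmetric])
  from has_integral_mult_right[OF this, of "1 / (c - b) ^ n"]
  have "(nest p n has_integral Re ?I / (c - b) ^ Suc n) {p ((x - b) / (c - b))..1}"
    using bc by (simp add: p mult.commute)
  then have "Re ?I = (c - b) ^ Suc n * nest p (Suc n) ((x - b) / (c - b))"
    using bc by (simp add: integral_unique)
  then have "?I = of_real ((c - b) ^ Suc n * nest p (Suc n) ((x - b) / (c - b)))"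
    using Im by (simp add: complex_eq_iff)
  moreover have "Kblock \<phi> b c ?f x = ?I" using Suc.prems by (simp add: Kblock_def)
  ultimately show ?case by (simp only: funpow.simps o_apply)
qed

lemma integral_Kblock_funpow_unit:
  "integral {b..c} ((Kblock \<phi> b c ^^ n) (unit_block b c)) = of_real ((c - b) ^ Suc n * iter_int p (Suc n))"
proof -
  let ?f = "(Kblock \<phi> b c ^^ n) (unit_block b c)"
  let ?I = "integral {b..c} ?f"
  have volt: "volterra b c (Kblock \<phi> b c) (c - b)"
    using volterra_Kblock[OF _ cont maps above] bc by simp
  have "(?f has_integral ?I) {b..c}"
    using bint_integrable[OF volterra_funpow_in[OF volt unit_block_in]] by blast
  \<comment> \<open>The formula for the iterates holds only on \<open>{b<..c}\<close>; the left
    endpoint is a null set.\<close>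
  then have I: "((\<lambda>t. complex_of_real ((c - b) ^ n * nest p n ((t - b) / (c - b)))) has_integral ?I) {b..c}"
    by (rule has_integral_spike[where S="{b}", rotated 2]) (auto simp: Kblock_funpow_unit)
  have "((\<lambda>t. 0::real) has_integral Im ?I) {b..c}"
    using has_integral_Im[OF I] by simp
  then have Im: "Im ?I = 0" by (simp add: has_integral_iff)
  have "((\<lambda>t. (c - b) ^ n * nest p n ((t - b) / (c - b))) has_integral Re ?I) (cbox b c)"
    using has_integral_Re[OF I] by simp
  from has_integral_affinity'[OF this, of "c - b" b]
  have "((\<lambda>s. (c - b) ^ n * nest p n s) has_integral Re ?I / (c - b)) {0..1}"
    using bc by (simp add: divide_inverse_commute[symmetric])
  from has_integral_mult_right[OF this, of "1 / (c - b) ^ n"]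
  have "(nest p n has_integral Re ?I / (c - b) ^ Suc n) {0..1}"
    using bc by (simp add: mult.commute)
  then have "Re ?I = (c - b) ^ Suc n * iter_int p (Suc n)"
    using bc by (simp add: integral_unique iter_int_def)
  then show ?thesis using Im by (simp add: complex_eq_iff)
qed

lemma char_series_sums:
  "(\<lambda>n. (- z) ^ n * of_real ((c - b) ^ Suc n * iter_int p (Suc n))) sums
     integral {b..c} (neumann (Kblock \<phi> b c) (- z) (unit_block b c))"
proof -
  have volt: "volterra b c (Kblock \<phi> b c) (c - b)"
    using volterra_Kblock[OF _ cont maps above] bc by simp
  have "(\<lambda>n. (- z) ^ n * integral {b..c} ((Kblock \<phi> b c ^^ n) (unit_block b c))) sums
     integral {b..c} (neumann (Kblock \<phi> b c) (- z) (unit_block b c))"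
  proof (rule neumann_functional_sums[OF volt unit_block_in, where K="c - b"])
    show "integral {b..c} (f + g) = integral {b..c} f + integral {b..c} g"
      if "f \<in> bint b c" "g \<in> bint b c" for f g
      using that by (simp add: plus_fun_def integral_add bint_integrable)
    show "integral {b..c} (fscale k f) = k * integral {b..c} f" for k f
      by (simp add: fscale_def)
    show "norm (integral {b..c} f) \<le> (c - b) * C" if "f \<in> bint b c" "\<And>x. norm (f x) \<le> C" for f C
      using bint_integral_bound[OF that, of b c] bc by (simp add: mult.commute)
  qed
  then show ?thesis by (simp only: integral_Kblock_funpow_unit)
qed

text \<open>The resolvent of \<open>K\<close> is taken at \<open>- z\<close>, that is,
  \<open>neumann\<close> here stands for the inverse of \<open>1 + z K\<close>. The powers of
  \<open>c - b\<close> produced by rescaling are absorbed in the argument of the series.\<close>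

lemma char_fun_eq:
  "1 + (\<Sum>n. (- (of_real (c - b) * z)) ^ Suc n * complex_of_real (iter_int p (Suc n))) =
     1 - z * integral {b..c} (neumann (Kblock \<phi> b c) (- z) (unit_block b c))"
proof -
  have "(\<lambda>n. - z * ((- z) ^ n * of_real ((c - b) ^ Suc n * iter_int p (Suc n)))) sums
     (- z * integral {b..c} (neumann (Kblock \<phi> b c) (- z) (unit_block b c)))"
    by (intro sums_mult char_series_sums)
  moreover have "- z * ((- z) ^ n * of_real ((c - b) ^ Suc n * iter_int p (Suc n))) =
     (- (of_real (c - b) * z)) ^ Suc n * complex_of_real (iter_int p (Suc n))" for n
  proof -
    have "- (of_real (c - b) * z) = of_real (c - b) * (- z)" by simp
    then show ?thesis by (simp only: power_mult_distrib of_real_mult of_real_power) simp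
  qed
  ultimately have "(\<lambda>n. (- (of_real (c - b) * z)) ^ Suc n * complex_of_real (iter_int p (Suc n))) sums
     (- z * integral {b..c} (neumann (Kblock \<phi> b c) (- z) (unit_block b c)))" by (simp only:)
  from sums_unique[OF this, symmetric] show ?thesis by simp
qed

text \<open>The integral of the resolvent is a power series in \<open>z\<close> that converges
  everywhere.\<close>

lemma char_fun_holomorphic:
  "(\<lambda>z. 1 - z * integral {b..c} (neumann (Kblock \<phi> b c) (- z) (unit_block b c))) holomorphic_on ball 0 r"
proof -
  have "(\<lambda>z. integral {b..c} (neumann (Kblock \<phi> b c) (- z) (unit_block b c))) holomorphic_on ball 0 r"
  proof (rule power_series_holomorphic)
    show "(\<lambda>n. ((- 1) ^ n * of_real ((c - b) ^ Suc n * iter_int p (Suc n))) * (z - 0) ^ n) sums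
        integral {b..c} (neumann (Kblock \<phi> b c) (- z) (unit_block b c))" for z
      using char_series_sums[of z] by (simp add: power_minus[of z] mult_ac)
  qed
  then show ?thesis by (intro holomorphic_intros)
qed

text \<open>The number \<open>m\<close> is the vanishing order of \<open>D\<close> at
  \<open>lam\<close>. Comparing the factorization of \<open>D\<close> with its expansion in powers
  of \<open>w\<close> shows that the first \<open>m\<close> Jordan chain conditions hold and that
  the next one fails.\<close>

lemma riesz_block_above:
  assumes lam: "lam \<noteq> 0"
  shows "\<exists>m h r. r > 0 \<and> h holomorphic_on ball lam r \<and> h lam \<noteq> 0 \<and>
    (\<forall>z\<in>ball lam r. 1 + (\<Sum>n. (- (of_real (c - b) * z)) ^ Suc n * complex_of_real (iter_int p (Suc n))) =
       (z - lam) ^ m * h z) \<and>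
    cfun.riesz (bint b c) (\<lambda>g. g - fscale lam (Vblock \<phi> b c g)) m"
proof -
  define K where "K = Kblock \<phi> b c"
  define one where "one = unit_block b c"
  define J where "J f = integral {b..c} f" for f :: "real \<Rightarrow> complex"
  define D where "D z = 1 - z * J (neumann K (- z) one)" for z
  have volt: "volterra b c K (c - b)"
    unfolding K_def using volterra_Kblock[OF _ cont maps above] bc by simp
  have one: "one \<in> bint b c" unfolding one_def by (rule unit_block_in)
  have J_add: "J (f + g) = J f + J g" if "f \<in> bint b c" "g \<in> bint b c" for f g
    using that by (simp add: J_def plus_fun_def integral_add bint_integrable)
  have J_scale: "J (fscale k f) = k * J f" for k f
    by (simp add: J_def fscale_def)
  have J_bound: "norm (J f) \<le> C * (c - b)" if "f \<in> bint b c" "\<And>x. norm (f x) \<le> C" for f C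
    unfolding J_def using bint_integral_bound[OF that, of b c] bc by simp

  obtain m h r where mhr: "r > 0" "h holomorphic_on ball lam r" "h lam \<noteq> 0"
    "\<And>z. z \<in> ball lam r \<Longrightarrow> D z = (z - lam) ^ m * h z"
  proof (cases "D lam = 0")
    case False
    have "D holomorphic_on ball 0 (norm lam + 1)"
      unfolding D_def J_def K_def one_def by (rule char_fun_holomorphic)
    moreover have "ball lam 1 \<subseteq> ball 0 (norm lam + 1)"
    proof
      fix z assume "z \<in> ball lam 1"
      then show "z \<in> ball 0 (norm lam + 1)"
        using norm_triangle_sub[of z lam] by (simp add: dist_norm norm_minus_commute)
    qed
    ultimately show ?thesis using that[of 1 D 0] False holomorphic_on_subset by force
  next
    case True
    let ?S = "ball (0::complex) (norm lam + 1)"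
    have "D 0 = 1" by (simp add: D_def)
    \<comment> \<open>The disc is large enough to contain both 0, where \<open>D\<close> is 1, and
      \<open>lam\<close>, where \<open>D\<close> vanishes.\<close>
    then have "\<not> D constant_on ?S"
    proof -
      have "lam \<in> ?S" "0 \<in> ?S" by (auto intro: add_nonneg_pos)
      then show ?thesis using True \<open>D 0 = 1\<close> unfolding constant_on_def by (metis zero_neq_one)
    qed
    moreover have "D holomorphic_on ?S"
      unfolding D_def J_def K_def one_def by (rule char_fun_holomorphic)
    ultimately obtain g r n where "0 < r" "g holomorphic_on ball lam r"
      "\<And>w. w \<in> ball lam r \<Longrightarrow> D w = (w - lam) ^ n * g w" "\<And>w. w \<in> ball lam r \<Longrightarrow> g w \<noteq> 0"
      using holomorphic_factor_zero_nonconstant[of D ?S lam] True by auto metis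
    then show ?thesis using that[of r g n] by simp
  qed

  define R where "R = neumann K (- lam)"
  define v where "v k = (R ^^ Suc k) one" for k
  define F where "F f = lam * J f" for f
  \<comment> \<open>\<open>1 + z K = (z / lam) (1 + lam K) + (1 - z / lam)\<close>, so \<open>(1 + z K)\<^sup>-\<^sup>1\<close> expands in powers of
    \<open>R\<close> with the local coordinate \<open>w\<close> at \<open>lam\<close>.\<close>
  define w where "w z = (z - lam) / z" for z
  define y where "y z = fscale z (neumann K (- z) one)" for z
  have R_in: "f \<in> bint b c \<Longrightarrow> R f \<in> bint b c" for f
    unfolding R_def by (rule neumann_in[OF volt])
  have R_pow_in: "f \<in> bint b c \<Longrightarrow> (R ^^ n) f \<in> bint b c" for f n
    using R_in by (induction n) auto
  have R_lin: "cfun.linear_on (bint b c) R"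
    unfolding R_def by (rule linear_on_neumann[OF volt])
  note R_add = cfun.hom_on_add[OF cfun.linear_onD(2)[OF R_lin]]
    and R_scale = cfun.hom_on_scale[OF cfun.linear_onD(2)[OF R_lin]]
  have R_bound: "norm ((R ^^ n) f x) \<le> C * exp (norm lam * (c - b)) ^ n"
    if f: "f \<in> bint b c" and C: "\<And>x. norm (f x) \<le> C" for f C n x
  proof (induction n arbitrary: x)
    case (Suc n)
    have "norm (R ((R ^^ n) f) x) \<le> C * exp (norm lam * (c - b)) ^ n * exp (norm (- lam) * (c - b))"
      using neumann_bound[OF volt R_pow_in[OF f], of n "C * exp (norm lam * (c - b)) ^ n" "- lam" x]
        Suc by (simp add: R_def)
    then show ?case by (simp add: mult_ac)
  qed (use C in simp)
  have y_in: "y z \<in> bint b c" for z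
    unfolding y_def by (intro cfun.subspace_scale[OF subspace_bint] neumann_in[OF volt] one)
  have y_eq: "y z = fscale lam (R one) + fscale (w z) (R (y z))" if z: "z \<noteq> 0" for z
  proof -
    let ?u = "neumann K (- z) one"
    have u: "?u - fscale (- z) (K ?u) = one" by (rule neumann_eq[OF volt one])
    have Ky: "K (y z) = fscale z (K ?u)"
      unfolding y_def using cfun.hom_on_scale[OF cfun.linear_onD(2)[OF volterra_lin[OF volt]] neumann_in[OF volt one]] .
    \<comment> \<open>With \<open>u = (1 + z K)^-1 1\<close> and \<open>y = z u\<close>, replacing
      \<open>z K u\<close> by \<open>1 - u\<close> turns \<open>(1 + lam K) y\<close> into
      \<open>lam 1 + (z - lam) u\<close>, and \<open>(z - lam) u\<close> equals
      \<open>w y\<close>.\<close>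
    have "y z - fscale (- lam) (K (y z)) = fscale lam one + fscale (w z) (y z)"
    proof
      fix x
      have "?u x + z * K ?u x = one x" using fun_cong[OF u, of x] by simp
      then have "one x = ?u x + z * K ?u x" by simp
      then show "(y z - fscale (- lam) (K (y z))) x = (fscale lam one + fscale (w z) (y z)) x"
        unfolding Ky using z by (simp add: y_def w_def field_simps)
    qed
    then have "y z = R (fscale lam one + fscale (w z) (y z))"
      using neumann_unique[OF volt y_in, of "- lam" z] by (simp only: R_def)
    also have "\<dots> = fscale lam (R one) + fscale (w z) (R (y z))"
      using R_add[OF cfun.subspace_scale[OF subspace_bint one] cfun.subspace_scale[OF subspace_bint y_in]]
        R_scale[OF one] R_scale[OF y_in] by simp
    finally show ?thesis .
  qed
  \<comment> \<open>Iterating \<open>y_eq\<close> produces a geometric expansion in \<open>w\<close>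
    whose coefficients are the numbers \<open>F (v k)\<close>, with an explicit remainder.\<close>
  have expansion: "J (y z) = (\<Sum>k<N. F (v k) * w z ^ k) + w z ^ N * J ((R ^^ N) (y z))" if z: "z \<noteq> 0" for N z
  proof (induction N)
    case (Suc N)
    have "(R ^^ N) (y z) = (R ^^ N) (fscale lam (R one) + fscale (w z) (R (y z)))"
      using y_eq[OF z] by simp
    also have "\<dots> = fscale lam ((R ^^ N) (R one)) + fscale (w z) ((R ^^ N) (R (y z)))"
    proof -
      note RN = cfun.linear_onD(2)[OF cfun.linear_on_funpow[OF R_lin, of N]]
      show ?thesis
        using cfun.hom_on_add[OF RN cfun.subspace_scale[OF subspace_bint R_in[OF one]] cfun.subspace_scale[OF subspace_bint R_in[OF y_in]]]
          cfun.hom_on_scale[OF RN R_in[OF one]] cfun.hom_on_scale[OF RN R_in[OF y_in]] by simp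
    qed
    finally have "(R ^^ N) (y z) = fscale lam (v N) + fscale (w z) ((R ^^ Suc N) (y z))"
      by (simp only: v_def funpow_Suc_right o_apply)
    then have "J ((R ^^ N) (y z)) = J (fscale lam (v N) + fscale (w z) ((R ^^ Suc N) (y z)))"
      by (rule arg_cong)
    also have "\<dots> = F (v N) + w z * J ((R ^^ Suc N) (y z))"
      unfolding v_def F_def
      by (subst J_add) (simp_all only: J_scale cfun.subspace_scale[OF subspace_bint] R_pow_in one y_in)
    finally show ?case using Suc by (simp only: sum.lessThan_Suc power_Suc) (simp add: algebra_simps)
  qed simp

  \<comment> \<open>Coefficients of \<open>D = 1 - J y\<close>. The 1 enters only at
    \<open>k = 0\<close>, in agreement with the chain conditions \<open>F (v 0) = 1\<close> and
    \<open>F (v k) = 0\<close> for \<open>k > 0\<close>.\<close>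
  define d where "d k = (if k = 0 then 1 else 0) - F (v k)" for k
  define rr where "rr z = - J ((R ^^ Suc m) (y z))" for z
  have D_expansion: "D z = (\<Sum>k\<le>m. d k * w z ^ k) + w z ^ Suc m * rr z" if z: "z \<noteq> 0" for z
  proof -
    have "D z = 1 - J (y z)" by (simp add: D_def y_def J_scale)
    also have "\<dots> = 1 - (\<Sum>k<Suc m. F (v k) * w z ^ k) + w z ^ Suc m * rr z"
      unfolding expansion[OF z, of "Suc m"] rr_def by simp
    also have "1 - (\<Sum>k<Suc m. F (v k) * w z ^ k) = (\<Sum>k\<le>m. d k * w z ^ k)"
    proof -
      have "(\<Sum>k\<le>m. (if k = 0 then 1 else 0) * w z ^ k) = (\<Sum>k\<in>{0::nat}. (1::complex))"
        by (rule sum.mono_neutral_cong_right) auto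
      then show ?thesis
        by (simp add: d_def left_diff_distrib sum_subtractf lessThan_Suc_atMost)
    qed
    finally show ?thesis .
  qed
  have coeffs: "(\<forall>k<m. d k = 0) \<and> d m = lam ^ m * h lam"
  proof (rule expansion_leading_coeff)
    show "at lam \<noteq> bot" by simp
    have "(w \<longlongrightarrow> (lam - lam) / lam) (at lam)"
      unfolding w_def by (intro tendsto_intros lam)
    then show "(w \<longlongrightarrow> 0) (at lam)" by simp
    have ev0: "\<forall>\<^sub>F z in at lam. z \<noteq> 0"
      using lam by (intro eventually_neq_at_within)
    have ev1: "\<forall>\<^sub>F z in at lam. z \<noteq> lam"
      by (simp add: eventually_at_filter)
    show "\<forall>\<^sub>F z in at lam. w z \<noteq> 0"
      using ev0 ev1 by eventually_elim (simp add: w_def)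
    have "continuous (at lam) h"
      using mhr holomorphic_on_imp_continuous_on continuous_on_interior by (metis centre_in_ball interior_open open_ball)
    then show "((\<lambda>z. z ^ m * h z) \<longlongrightarrow> lam ^ m * h lam) (at lam)"
      by (intro tendsto_intros) (simp add: continuous_at)
    have ball: "\<forall>\<^sub>F z in at lam. z \<in> ball lam 1"
      using eventually_at_ball[of 1 lam UNIV] by (rule eventually_mono) auto
    \<comment> \<open>On the unit disc around \<open>lam\<close> the exponential bounds for
      \<open>neumann\<close> are uniform in \<open>z\<close>, hence so is the bound on the
      remainder.\<close>
    then show "\<forall>\<^sub>F z in at lam. norm (rr z) \<le>
        (norm lam + 1) * exp ((norm lam + 1) * (c - b)) * exp (norm lam * (c - b)) ^ Suc m * (c - b)"
    proof eventually_elim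
      case (elim z)
      have z: "norm z \<le> norm lam + 1"
        using elim norm_triangle_ineq2[of z lam] by (simp add: dist_norm norm_minus_commute)
      have "norm (y z x) \<le> (norm lam + 1) * exp ((norm lam + 1) * (c - b))" for x
      proof -
        have "norm (neumann K (- z) one x) \<le> 1 * exp (norm (- z) * (c - b))"
          by (rule neumann_bound[OF volt one]) (simp add: one_def unit_block_def)
        also have "\<dots> \<le> exp ((norm lam + 1) * (c - b))"
          using z bc by (simp add: mult_right_mono)
        finally show ?thesis
          unfolding y_def fscale_apply norm_mult using z by (intro mult_mono) auto
      qed
      from J_bound[OF R_pow_in[OF y_in] R_bound[OF y_in this]]
      show ?case by (simp only: rr_def norm_minus_cancel)
    qed
    have "\<forall>\<^sub>F z in at lam. z \<in> ball lam r"
      using eventually_at_ball[OF mhr(1), of lam UNIV] by (rule eventually_mono) auto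
    then show "\<forall>\<^sub>F z in at lam. w z ^ m * (z ^ m * h z) = (\<Sum>k\<le>m. d k * w z ^ k) + w z ^ Suc m * rr z"
      using ev0
    proof eventually_elim
      case (elim z)
      \<comment> \<open>Since \<open>w z * z = z - lam\<close>, the factorization of
        \<open>D\<close> in powers of \<open>z - lam\<close> becomes one in powers of
        \<open>w\<close>, with cofactor \<open>z ^ m * h z\<close>.\<close>
      have "w z ^ m * (z ^ m * h z) = (w z * z) ^ m * h z" by (simp add: power_mult_distrib)
      also have "\<dots> = D z" using elim mhr(4) by (simp add: w_def)
      finally show ?case using D_expansion elim(2) by simp
    qed
  qed

  have "cfun.riesz (bint b c) (\<lambda>g. g - fscale lam (Vblock \<phi> b c g)) m"
  proof (rule cfun.riesz_rank_one_perturbation[where R=R and G="\<lambda>g. g - fscale (- lam) (K g)" and F=F and p=one])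
    have V_eq: "Vblock \<phi> b c g = fscale (J g) one - K g" if "g \<in> bint b c" for g
      unfolding J_def one_def K_def using Vblock_eq_Kblock[OF _ cont maps that] bc by simp
    show "g - fscale lam (Vblock \<phi> b c g) = g - fscale (- lam) (K g) - fscale (F g) one"
      if "g \<in> bint b c" for g
      unfolding V_eq[OF that] by (simp add: fun_eq_iff F_def algebra_simps)
    show "cfun.linear_on (bint b c) (\<lambda>g. g - fscale lam (Vblock \<phi> b c g))"
      using linear_on_Vblock[OF _ cont maps] bc by (intro linear_on_id_minus) simp
    show "R g \<in> bint b c" if "g \<in> bint b c" for g by (rule R_in[OF that])
    show "R g - fscale (- lam) (K (R g)) = g" if "g \<in> bint b c" for g
      unfolding R_def by (rule neumann_eq[OF volt that])
    show "R (g - fscale (- lam) (K g)) = g" if "g \<in> bint b c" for g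
      unfolding R_def by (rule neumann_unique[OF volt that])
    show "R (fscale k g) = fscale k (R g)" if "g \<in> bint b c" for k g by (rule R_scale[OF that])
    show "one \<in> bint b c" by (rule one)
    show "one \<noteq> 0" using bc by (auto simp: fun_eq_iff one_def unit_block_def intro!: exI[of _ c])
    show "F ((R ^^ Suc k) one) = (if k = 0 then 1 else 0)" if "k < m" for k
    proof -
      have "d k = 0" using coeffs that by blast
      then have "(if k = 0 then 1 else 0) = F (v k)" by (simp only: d_def right_minus_eq)
      from this[symmetric] show ?thesis by (simp only: v_def)
    qed
    show "F ((R ^^ Suc m) one) \<noteq> (if m = 0 then 1 else 0)"
    proof
      assume "F ((R ^^ Suc m) one) = (if m = 0 then 1 else 0)"
      then have "d m = 0" by (simp only: d_def v_def diff_self)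
      then show False using coeffs lam mhr(3) by simp
    qed
  qed
  moreover have "1 + (\<Sum>n. (- (of_real (c - b) * z)) ^ Suc n * complex_of_real (iter_int p (Suc n))) = D z" for z
    unfolding D_def J_def K_def one_def by (rule char_fun_eq)
  ultimately show ?thesis using mhr by (intro exI[of _ m] exI[of _ h] exI[of _ r]) auto
qed

end

section \<open>Gluing adjacent blocks\<close>

lemma bint_restrict:
  assumes f: "f \<in> bint b c"
  shows "(\<lambda>x. if x \<in> {b'<..c'} then f x else 0) \<in> bint b' c'"
proof -
  obtain C where C: "C \<ge> 0" "\<And>x. norm (f x) \<le> C" using f bint_bounded by metis
  show ?thesis
  proof (rule bintI[where C=C])
    fix u v
    have "f integrable_on {b'..c'} \<inter> {u..v}" using bint_integrable[OF f] by simp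
    then have "(\<lambda>x. if x \<in> {b'..c'} then f x else 0) integrable_on {u..v}"
      by (simp only: integrable_restrict_Int)
    then show "(\<lambda>x. if x \<in> {b'<..c'} then f x else 0) integrable_on {u..v}"
      by (rule integrable_spike[where S="{b'}"]) auto
    show "norm (if x \<in> {b'<..c'} then f x else 0) \<le> C" for x using C by simp
  qed auto
qed

lemma bint_mono:
  assumes "f \<in> bint b c" "b' \<le> b" "c \<le> c'"
  shows "f \<in> bint b' c'"
  using assms by (auto simp: bint_def)

text \<open>Restriction to the left block is the quotient map, and the functions supported in the
  right block are its kernel. The fixed point condition on \<open>d\<close> enters as invariance of
  both halves under \<open>\<phi>\<close>.\<close>

lemma riesz_split:
  assumes order: "b \<le> d" "d \<le> c"
    and cont: "continuous_on {b..c} \<phi>"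
    and left: "\<phi> ` {b..d} \<subseteq> {b..d}" and right: "\<phi> ` {d..c} \<subseteq> {d..c}"
    and M: "cfun.riesz (bint d c) (\<lambda>g. g - fscale lam (Vblock \<phi> d c g)) M"
    and N: "cfun.riesz (bint b d) (\<lambda>g. g - fscale lam (Vblock \<phi> b d g)) N"
  shows "cfun.riesz (bint b c) (\<lambda>g. g - fscale lam (Vblock \<phi> b c g)) (N + M)"
proof (rule cfun.riesz_extension[where S="\<lambda>f x. if x \<in> {b<..d} then f x else 0"])
  let ?S = "\<lambda>f x. if x \<in> {b<..d} then f x else (0::complex)"
  have maps: "\<phi> ` {b..c} \<subseteq> {b..c}"
  proof -
    have "{b..c} = {b..d} \<union> {d..c}" using order by auto
    then show ?thesis using left right order by (auto simp: image_subset_iff)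
  qed
  show "cfun.linear_on (bint b c) (\<lambda>g. g - fscale lam (Vblock \<phi> b c g))"
    using linear_on_Vblock[OF _ cont maps] order by (intro linear_on_id_minus) simp
  show "cfun.riesz (bint d c) (\<lambda>g. g - fscale lam (Vblock \<phi> b c g)) M"
  proof (rule cfun.riesz_cong[OF M])
    fix f assume f: "f \<in> bint d c"
    \<comment> \<open>For \<open>f\<close> supported to the right of \<open>d\<close>, the part of
      each integral to the left of \<open>d\<close> vanishes, so the operators of the large and of
      the right block agree on \<open>f\<close>.\<close>
    have zero: "integral {b..y} f = 0" if "y \<le> d" for y
      using that by (intro integral_unique has_integral_is_0) (auto simp: bint_outside[OF f])
    have "Vblock \<phi> b c f x = Vblock \<phi> d c f x" for x
    proof (cases "x \<in> {d<..c}")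
      case True
      then have "\<phi> x \<in> {d..c}" using right by (auto simp: image_subset_iff)
      then have "integral {b..\<phi> x} f = integral {b..d} f + integral {d..\<phi> x} f"
        using Henstock_Kurzweil_Integration.integral_combine[of b d "\<phi> x" f] order bint_integrable[OF f] by simp
      then show ?thesis using True order zero[of d] by (simp add: Vblock_def)
    next
      case False
      have "Vblock \<phi> b c f x = 0"
      proof (cases "x \<in> {b<..d}")
        case True
        then have "\<phi> x \<le> d" using left by (auto simp: image_subset_iff)
        then show ?thesis using zero by (simp add: Vblock_def)
      qed (use False order in \<open>auto simp: Vblock_def\<close>)
      moreover have "Vblock \<phi> d c f x = 0" unfolding Vblock_def using False by (rule if_not_P)
      ultimately show ?thesis by simp
    qed
    then have "Vblock \<phi> b c f = Vblock \<phi> d c f" by (rule ext)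
    then show "f - fscale lam (Vblock \<phi> b c f) = f - fscale lam (Vblock \<phi> d c f)" by (simp only:)
  qed
  show "cfun.riesz (bint b d) (\<lambda>g. g - fscale lam (Vblock \<phi> b d g)) N" by (rule N)
  show "cfun.hom_on (bint b c) ?S" by (auto simp: cfun.hom_on_def fun_eq_iff)
  show "?S ` bint b c = bint b d"
  proof (intro subset_antisym subsetI)
    show "g \<in> bint b d" if "g \<in> ?S ` bint b c" for g using that bint_restrict by auto
    show "g \<in> ?S ` bint b c" if "g \<in> bint b d" for g
    proof (rule image_eqI)
      show "g = ?S g" using bint_outside[OF that] by (auto simp: fun_eq_iff)
      show "g \<in> bint b c" using bint_mono[OF that] order by simp
    qed
  qed
  show "bint d c = {f \<in> bint b c. ?S f = 0}"
  proof (intro subset_antisym subsetI)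
    show "f \<in> {f \<in> bint b c. ?S f = 0}" if "f \<in> bint d c" for f
      using bint_mono[OF that order(1) order_refl] bint_outside[OF that] by (auto simp: fun_eq_iff)
    fix f assume "f \<in> {f \<in> bint b c. ?S f = 0}"
    then have f: "f \<in> bint b c" "?S f = 0" by auto
    have "f x = 0" if "x \<notin> {d<..c}" for x
      using bint_outside[OF f(1), of x] fun_cong[OF f(2), of x] that by (auto split: if_splits)
    then show "f \<in> bint d c" using f(1) by (auto simp: bint_def)
  qed
  show "?S (f - fscale lam (Vblock \<phi> b c f)) = ?S f - fscale lam (Vblock \<phi> b d (?S f))" if f: "f \<in> bint b c" for f
  proof
    fix x
    \<comment> \<open>For \<open>x\<close> in the left block the upper limit \<open>\<phi> x\<close>
      stays at most \<open>d\<close>, so only the values of \<open>f\<close> in the left block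
      matter.\<close>
    have "Vblock \<phi> b c f x = Vblock \<phi> b d (?S f) x" if x: "x \<in> {b<..d}"
    proof -
      have "\<phi> x \<le> d" using x left by (auto simp: image_subset_iff)
      then have "integral {b..\<phi> x} f = integral {b..\<phi> x} (?S f)"
        by (intro integral_spike[where S="{b}"]) auto
      then show ?thesis using x order by (simp add: Vblock_def)
    qed
    then show "?S (f - fscale lam (Vblock \<phi> b c f)) x = (?S f - fscale lam (Vblock \<phi> b d (?S f))) x"
      by (auto simp: Vblock_def)
  qed
qed

text \<open>Without interior fixed points the graph stays on one side of the diagonal: above it the
  rank one analysis applies, below it the operator is Volterra and the multiplicity is 0.\<close>

lemma riesz_block:
  assumes bc: "b < c" and cont: "continuous_on {b..c} \<phi>" and mono: "mono_on {b..c} \<phi>"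
    and maps: "\<phi> ` {b..c} \<subseteq> {b..c}" and nofix: "\<And>x. x \<in> {b<..<c} \<Longrightarrow> \<phi> x \<noteq> x"
    and p: "\<And>s. p s = (\<phi> (s * (c - b) + b) - b) / (c - b)" and lam: "lam \<noteq> 0"
  shows "\<exists>m h r. r > 0 \<and> h holomorphic_on ball lam r \<and> h lam \<noteq> 0 \<and>
    (\<forall>z\<in>ball lam r. Dfun p (of_real (c - b) * z) = (z - lam) ^ m * h z) \<and>
    cfun.riesz (bint b c) (\<lambda>g. g - fscale lam (Vblock \<phi> b c g)) m"
proof -
  have p_gt: "p s > s \<longleftrightarrow> \<phi> (s * (c - b) + b) > s * (c - b) + b" for s
    using bc by (simp add: p field_simps)
  have in_block: "s * (c - b) + b \<in> {b<..<c}" if "s \<in> {0<..<1}" for s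
  proof -
    define t where "t = s * (c - b)"
    have "0 < t" "t < 1 * (c - b)"
      unfolding t_def using that bc by (auto intro!: mult_strict_right_mono mult_pos_pos)
    then show ?thesis by (simp add: t_def[symmetric])
  qed
  show ?thesis
  proof (cases "\<exists>x\<in>{b<..<c}. \<phi> x < x")
    case False
    then have gt: "\<phi> x > x" if "x \<in> {b<..<c}" for x using nofix that by force
    \<comment> \<open>The inequality at the endpoint follows from monotonicity and the inequality at
      points arbitrarily close to \<open>c\<close>.\<close>
    have "c \<le> \<phi> c"
    proof (rule dense_le_bounded[OF bc])
      fix w assume w: "b < w" "w < c"
      have "\<phi> w \<le> \<phi> c" by (rule mono_onD[OF mono]) (use w in auto)
      then show "w \<le> \<phi> c" using gt[of w] w by simp
    qed
    then have above: "x \<le> \<phi> x" if "x \<in> {b<..c}" for x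
      using gt[of x] that by (cases "x = c") auto
    have "\<forall>x\<in>{0<..<1}. p x > x" using p_gt gt in_block by simp
    then have "Dfun p z = 1 + (\<Sum>n. (- z) ^ Suc n * complex_of_real (iter_int p (Suc n)))" for z
      unfolding Dfun_def by (rule if_P)
    then show ?thesis
      using riesz_block_above[OF bc cont maps above p lam] by (simp only:)
  next
    case True
    then obtain x0 where x0: "x0 \<in> {b<..<c}" "\<phi> x0 < x0" by auto
    have lt: "\<phi> x < x" if x: "x \<in> {b<..<c}" for x
    proof (rule ccontr)
      assume "\<not> \<phi> x < x"
      \<comment> \<open>Intermediate value argument: a change of sign of \<open>\<phi> x - x\<close>
        would produce a fixed point inside the block.\<close>
      have "connected ((\<lambda>x. \<phi> x - x) ` {b<..<c})"
        by (intro connected_continuous_image continuous_intros continuous_on_subset[OF cont]) auto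
      then have "0 \<in> (\<lambda>x. \<phi> x - x) ` {b<..<c}"
        using x x0 \<open>\<not> \<phi> x < x\<close> connectedD_interval[of _ "\<phi> x0 - x0" "\<phi> x - x" 0] by auto
      then show False using nofix by auto
    qed
    have below: "\<phi> x \<le> x" if "x \<in> {b<..c}" for x
    proof (cases "x = c")
      case True
      then show ?thesis using maps bc by (auto simp: image_subset_iff)
    qed (use lt[of x] that in auto)
    \<comment> \<open>A single point suffices to select the second branch of
      \<open>Dfun\<close>.\<close>
    have "\<not> p (1/2) > 1/2" using p_gt[of "1/2"] lt[OF in_block[of "1/2"]] by simp
    then have "\<not> (\<forall>x\<in>{0<..<1}. p x > x)" by (auto intro!: bexI[of _ "1/2"])
    then have "Dfun p z = 1" for z unfolding Dfun_def by (rule if_not_P)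
    moreover have "cfun.riesz (bint b c) (\<lambda>g. g - fscale lam (Vblock \<phi> b c g)) 0"
      using riesz_id_minus_volterra[OF volterra_Vblock[OF _ cont maps below]] bc by simp
    ultimately show ?thesis
      by (intro exI[of _ 0] exI[of _ "\<lambda>_. 1"] exI[of _ 1]) auto
  qed
qed

section \<open>Generalized eigenfunctions in the space of square integrable functions\<close>

lemma bint_L2:
  assumes f: "f \<in> bint b c"
  shows "L2_01 f"
proof -
  obtain C where C: "C \<ge> 0" "\<And>x. norm (f x) \<le> C" using f bint_bounded by metis
  have meas: "f \<in> borel_measurable (lebesgue_on {0..1})"
    by (rule integrable_imp_measurable[OF bint_integrable[OF f]])
  have "(\<lambda>x. (norm (f x))\<^sup>2) absolutely_integrable_on {0..1}"
  proof (rule measurable_bounded_by_integrable_imp_absolutely_integrable)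
    show "(\<lambda>x. (norm (f x))\<^sup>2) \<in> borel_measurable (lebesgue_on {0..1})"
      using meas by measurable
    show "(\<lambda>x. C\<^sup>2) integrable_on {0..1::real}" by (rule integrable_const_ivl)
    show "norm ((norm (f x))\<^sup>2) \<le> C\<^sup>2" if "x \<in> {0..1}" for x
      using power_mono[OF C(2)] by simp
  qed auto
  then show ?thesis
    using meas by (simp add: L2_01_def measurable_on_iff_borel_measurable set_lebesgue_integral_eq_integral)
qed

text \<open>On a set of finite measure the majorant \<open>1 + |f|^2\<close> of \<open>|f|\<close>
  is integrable.\<close>

lemma L2_integrable:
  assumes "L2_01 f"
  shows "f integrable_on {0..1}"
proof -
  have "f absolutely_integrable_on {0..1}"
  proof (rule measurable_bounded_by_integrable_imp_absolutely_integrable)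
    show "f \<in> borel_measurable (lebesgue_on {0..1})"
      using assms by (simp add: L2_01_def measurable_on_iff_borel_measurable)
    show "(\<lambda>x. 1 + (norm (f x))\<^sup>2) integrable_on {0..1}"
      using assms by (intro integrable_add) (auto simp: L2_01_def)
    show "norm (f x) \<le> 1 + (norm (f x))\<^sup>2" for x
      using sum_squares_bound[of 1 "norm (f x)"] norm_ge_zero[of "f x"] unfolding power_one by linarith
  qed auto
  then show ?thesis by (simp add: set_lebesgue_integral_eq_integral)
qed

lemma ae_eq_integral:
  assumes "ae_eq_01 f g" "{u..v} \<subseteq> {0..1}"
  shows "integral {u..v} f = integral {u..v} g"
  using assms by (intro integral_spike[where S="{x \<in> {0..1}. f x \<noteq> g x}"]) (auto simp: ae_eq_01_def)

lemma ae_zero_integral: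
  assumes "ae_zero_01 f" "{u..v} \<subseteq> {0..1}"
  shows "integral {u..v} f = 0"
  using ae_eq_integral[of f "\<lambda>_. 0" u v] assms by (simp add: ae_eq_01_def ae_zero_01_def)

section \<open>Pointwise representatives of almost everywhere classes\<close>

context
  fixes phi :: "real \<Rightarrow> real" and lam :: complex
  assumes cont: "continuous_on {0..1} phi" and maps: "phi ` {0..1} \<subseteq> {0..1}" and lam: "lam \<noteq> 0"
begin

text \<open>Up to the factor \<open>- lam\<close> and the value at 0 this is
  \<open>Vshift phi (1 / lam)\<close>, normalized as identity minus an integral operator.\<close>

definition char_op :: "(real \<Rightarrow> complex) \<Rightarrow> real \<Rightarrow> complex" where
  "char_op g = g - fscale lam (Vblock phi 0 1 g)"

lemma linear_on_char_op: "cfun.linear_on (bint 0 1) char_op"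
  unfolding char_op_def[abs_def] using linear_on_Vblock[OF _ cont maps] by (intro linear_on_id_minus) simp

lemma phi_subset: "x \<in> {0..1} \<Longrightarrow> {0..phi x} \<subseteq> {0..1}"
  using maps by (auto simp: image_subset_iff)

lemma Vop_continuous:
  assumes "f integrable_on {0..1}"
  shows "continuous_on {0..1} (Vop phi f)"
  unfolding Vop_def by (rule continuous_on_compose2[OF indefinite_integral_continuous_1[OF assms] cont maps])

text \<open>The point 0 is excluded: \<open>Vblock\<close> is set to 0 there, while
  \<open>Vop\<close> need not vanish, as \<open>phi 0\<close> may be positive. The discrepancy does
  not affect later integrals.\<close>

lemma Vshift_funpow_bint:
  assumes "f \<in> bint 0 1" "x \<in> {0<..1}"
  shows "(Vshift phi (1 / lam) ^^ n) f x = (- 1 / lam) ^ n * (char_op ^^ n) f x"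
  using assms(2)
proof (induction n arbitrary: x)
  case (Suc n)
  let ?h = "(char_op ^^ n) f"
  have "integral {0..phi x} ((Vshift phi (1 / lam) ^^ n) f) = integral {0..phi x} (\<lambda>t. (- 1 / lam) ^ n * ?h t)"
  proof (rule integral_spike[where S="{0}"])
    fix t assume "t \<in> {0..phi x} - {0}"
    then show "(- 1 / lam) ^ n * ?h t = (Vshift phi (1 / lam) ^^ n) f t"
      using phi_subset[of x] Suc.prems Suc.IH[of t] by auto
  qed simp
  also have "\<dots> = (- 1 / lam) ^ n * Vblock phi 0 1 ?h x"
    using Suc.prems by (simp add: Vblock_def)
  finally have "(Vshift phi (1 / lam) ^^ Suc n) f x =
      (- 1 / lam) ^ n * Vblock phi 0 1 ?h x - 1 / lam * ((- 1 / lam) ^ n * ?h x)"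
    using Suc by (simp add: Vshift_def[of _ _ "(Vshift phi (1 / lam) ^^ n) f"] Vop_def)
  also have "\<dots> = (- 1 / lam) ^ Suc n * (char_op ^^ Suc n) f x"
    using lam by (simp add: char_op_def field_simps)
  finally show ?case .
qed simp

lemma nil_space_subset_gen_eigenspace:
  assumes "f \<in> cfun.nil_space (bint 0 1) char_op"
  shows "f \<in> gen_eigenspace phi (1 / lam)"
proof -
  obtain n where f: "f \<in> bint 0 1" "(char_op ^^ n) f = 0"
    using assms by (auto simp: cfun.nil_space_def)
  have "{x \<in> {0..1}. (Vshift phi (1 / lam) ^^ n) f x \<noteq> 0} \<subseteq> {0}"
  proof
    fix x assume x: "x \<in> {x \<in> {0..1}. (Vshift phi (1 / lam) ^^ n) f x \<noteq> 0}"
    have "(Vshift phi (1 / lam) ^^ n) f x = 0" if "x \<in> {0<..1}"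
      unfolding Vshift_funpow_bint[OF f(1) that] f(2) by simp
    then show "x \<in> {0}" using x by (cases "x = 0") auto
  qed
  then have "ae_zero_01 ((Vshift phi (1 / lam) ^^ n) f)"
    unfolding ae_zero_01_def by (rule negligible_subset[rotated]) simp
  then show ?thesis using bint_L2[OF f(1)] unfolding gen_eigenspace_def by blast
qed

text \<open>The identity \<open>f = lam (V f - (V - 1 / lam) f)\<close> improves regularity:
  \<open>V f\<close> is continuous, and \<open>(V - 1 / lam) f\<close> has a good representative by
  induction on the exponent.\<close>

lemma ae_kernel_representative:
  assumes "f integrable_on {0..1}" "ae_zero_01 ((Vshift phi (1 / lam) ^^ n) f)"
  shows "\<exists>g\<in>bint 0 1. ae_eq_01 f g \<and> (char_op ^^ n) g = 0"
  using assms
proof (induction n arbitrary: f)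
  case 0
  then show ?case
    using cfun.subspace_0[OF subspace_bint[of 0 1]]
    by (intro bexI[of _ 0]) (auto simp: ae_zero_01_def ae_eq_01_def)
next
  case (Suc n)
  have intble: "Vshift phi (1 / lam) f integrable_on {0..1}"
    unfolding Vshift_def
    by (intro integrable_diff integrable_continuous_interval Vop_continuous integrable_on_mult_right Suc.prems)
  have "ae_zero_01 ((Vshift phi (1 / lam) ^^ n) (Vshift phi (1 / lam) f))"
    using Suc.prems(2) by (simp only: funpow_Suc_right o_apply)
  from Suc.IH[OF intble this]
  obtain g where g: "g \<in> bint 0 1" "ae_eq_01 (Vshift phi (1 / lam) f) g" "(char_op ^^ n) g = 0" by blast
  \<comment> \<open>\<open>V f\<close> with the value at 0 replaced by 0, so that it belongs to
    \<open>bint 0 1\<close>.\<close>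
  define r where "r = (\<lambda>x. if x \<in> {0<..1} then Vop phi f x else 0)"
  define f' where "f' = fscale lam (r - g)"
  have r: "r \<in> bint 0 1"
    unfolding r_def by (intro bint_restrict_continuous Vop_continuous Suc.prems)
  have f': "f' \<in> bint 0 1"
    unfolding f'_def by (intro cfun.subspace_scale[OF subspace_bint] cfun.subspace_diff[OF subspace_bint] r g)
  have ae: "ae_eq_01 f f'"
    unfolding ae_eq_01_def
  proof (rule negligible_subset)
    show "negligible (insert 0 {x \<in> {0..1}. Vshift phi (1 / lam) f x \<noteq> g x})"
      using g(2) by (simp add: ae_eq_01_def)
    show "{x \<in> {0..1}. f x \<noteq> f' x} \<subseteq> insert 0 {x \<in> {0..1}. Vshift phi (1 / lam) f x \<noteq> g x}"
    proof
      fix x assume x: "x \<in> {x \<in> {0..1}. f x \<noteq> f' x}"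
      have "f' x = f x" if "x \<noteq> 0" "Vshift phi (1 / lam) f x = g x"
        using that x lam by (simp add: f'_def r_def Vshift_def flip: that(2))
      then show "x \<in> insert 0 {x \<in> {0..1}. Vshift phi (1 / lam) f x \<noteq> g x}" using x by auto
    qed
  qed
  \<comment> \<open>Integrals ignore null sets, so the operator sends the representative
    \<open>f'\<close> to the exact function \<open>r\<close>, not just to one equal almost
    everywhere.\<close>
  have "Vblock phi 0 1 f' = r"
  proof
    fix x
    show "Vblock phi 0 1 f' x = r x"
      using ae_eq_integral[OF ae phi_subset[of x]] by (auto simp: Vblock_def r_def Vop_def)
  qed
  then have "char_op f' = fscale (- lam) g" by (simp add: char_op_def f'_def fun_eq_iff algebra_simps)
  then have "(char_op ^^ Suc n) f' = (char_op ^^ n) (fscale (- lam) g)"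
    by (simp only: funpow_Suc_right o_apply)
  also have "\<dots> = fscale (- lam) ((char_op ^^ n) g)"
    by (rule cfun.hom_on_scale[OF cfun.linear_onD(2)[OF cfun.linear_on_funpow[OF linear_on_char_op]] g(1)])
  also have "\<dots> = 0" by (simp only: g(3)) (simp add: fun_eq_iff)
  finally show ?case using f' ae by blast
qed

lemma gen_eigenspace_representative:
  assumes "f \<in> gen_eigenspace phi (1 / lam)"
  shows "\<exists>g\<in>cfun.nil_space (bint 0 1) char_op. ae_eq_01 f g"
proof -
  obtain n where "L2_01 f" "ae_zero_01 ((Vshift phi (1 / lam) ^^ n) f)"
    using assms by (auto simp: gen_eigenspace_def)
  then obtain g where "g \<in> bint 0 1" "ae_eq_01 f g" "(char_op ^^ n) g = 0"
    using ae_kernel_representative L2_integrable by blast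
  then show ?thesis by (auto simp: cfun.nil_space_def)
qed

text \<open>The operator annihilates a null function exactly, so \<open>char_op\<close> fixes it;
  being nilpotent on it as well, \<open>char_op\<close> forces it to be 0. Hence pointwise
  representatives are unique.\<close>

lemma nil_space_ae_zero:
  assumes f: "f \<in> cfun.nil_space (bint 0 1) char_op" and ae: "ae_zero_01 f"
  shows "f = 0"
proof -
  obtain n where n: "f \<in> bint 0 1" "(char_op ^^ n) f = 0" using f by (auto simp: cfun.nil_space_def)
  have "Vblock phi 0 1 f = 0"
    using ae_zero_integral[OF ae phi_subset] by (auto simp: Vblock_def fun_eq_iff)
  then have "char_op f = f" by (simp add: char_op_def fun_eq_iff)
  then have "(char_op ^^ n) f = f" by (induction n) simp_all
  then show ?thesis using n(2) by simp
qed

context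
  fixes M :: nat
  assumes M: "cfun.riesz (bint 0 1) char_op M"
begin

text \<open>Existence and uniqueness of representatives carry independent families between the
  generalized eigenspace modulo null functions and the pointwise generalized kernel.\<close>

lemma alg_mult_eq: "alg_mult phi (1 / lam) = enat M"
proof -
  have dim: "cfun.has_dim (cfun.nil_space (bint 0 1) char_op) M"
    using M by (simp add: cfun.riesz_def)
  have sub: "cfun.subspace (cfun.nil_space (bint 0 1) char_op)"
    by (rule cfun.subspace_nil_space[OF linear_on_char_op])
  let ?P = "\<lambda>m. \<exists>fs :: nat \<Rightarrow> real \<Rightarrow> complex.
      (\<forall>i<m. fs i \<in> gen_eigenspace phi (1 / lam)) \<and>
      (\<forall>c :: nat \<Rightarrow> complex. ae_zero_01 (\<lambda>x. \<Sum>i<m. c i * fs i x) \<longrightarrow> (\<forall>i<m. c i = 0))"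
  have le: "m \<le> M" if m: "?P m" for m
  proof -
    obtain fs where *: "(\<forall>i<m. fs i \<in> gen_eigenspace phi (1 / lam)) \<and>
      (\<forall>c :: nat \<Rightarrow> complex. ae_zero_01 (\<lambda>x. \<Sum>i<m. c i * fs i x) \<longrightarrow> (\<forall>i<m. c i = 0))"
      using m by (rule exE)
    then have fs: "\<And>i. i < m \<Longrightarrow> fs i \<in> gen_eigenspace phi (1 / lam)"
      and ind: "\<And>c i. ae_zero_01 (\<lambda>x. \<Sum>i<m. c i * fs i x) \<Longrightarrow> i < m \<Longrightarrow> c i = 0"
      by blast+
    have "\<forall>i\<in>{..<m}. \<exists>g. g \<in> cfun.nil_space (bint 0 1) char_op \<and> ae_eq_01 (fs i) g"
      using gen_eigenspace_representative[OF fs] by auto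
    from bchoice[OF this] obtain gs where gs: "\<And>i. i < m \<Longrightarrow> gs i \<in> cfun.nil_space (bint 0 1) char_op"
      "\<And>i. i < m \<Longrightarrow> ae_eq_01 (fs i) (gs i)" by auto
    show ?thesis
    proof (rule cfun.has_dim_family_le[OF dim gs(1)])
      fix c i assume c: "(\<Sum>i<m. fscale (c i) (gs i)) = 0" and i: "i < m"
      have "ae_zero_01 (\<lambda>x. \<Sum>i<m. c i * fs i x)"
        unfolding ae_zero_01_def
      proof (rule negligible_subset)
        show "negligible (\<Union>i<m. {x \<in> {0..1}. fs i x \<noteq> gs i x})"
          using gs(2) by (intro negligible_Union) (auto simp: ae_eq_01_def)
        show "{x \<in> {0..1}. (\<Sum>i<m. c i * fs i x) \<noteq> 0} \<subseteq> (\<Union>i<m. {x \<in> {0..1}. fs i x \<noteq> gs i x})"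
        proof (rule subsetI, rule ccontr)
          fix x assume x: "x \<in> {x \<in> {0..1}. (\<Sum>i<m. c i * fs i x) \<noteq> 0}"
            and "x \<notin> (\<Union>i<m. {x \<in> {0..1}. fs i x \<noteq> gs i x})"
          then have "(\<Sum>i<m. c i * fs i x) = (\<Sum>i<m. c i * gs i x)"
            by (intro sum.cong) auto
          also have "\<dots> = 0" using fun_cong[OF c, of x] by (simp add: sum_fun_apply)
          finally show False using x by simp
        qed
      qed
      then show "c i = 0" using ind i by blast
    qed
  qed
  have "?P M"
  proof (rule cfun.has_dim_obtain_family[OF dim])
    fix f assume f: "\<And>i. i < M \<Longrightarrow> f i \<in> cfun.nil_space (bint 0 1) char_op"
      and ind: "\<And>c i. (\<Sum>i<M. fscale (c i) (f i)) = 0 \<Longrightarrow> i < M \<Longrightarrow> c i = 0"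
    have "c i = 0" if ae: "ae_zero_01 (\<lambda>x. \<Sum>i<M. c i * f i x)" and i: "i < M" for c i
    proof (rule ind[OF nil_space_ae_zero i])
      show "(\<Sum>i<M. fscale (c i) (f i)) \<in> cfun.nil_space (bint 0 1) char_op"
        using f by (intro cfun.subspace_sum[OF sub] cfun.subspace_scale[OF sub]) auto
      have "(\<Sum>i<M. fscale (c i) (f i)) = (\<lambda>x. \<Sum>i<M. c i * f i x)"
        by (simp add: fun_eq_iff sum_fun_apply)
      then show "ae_zero_01 (\<Sum>i<M. fscale (c i) (f i))" using ae by simp
    qed
    then show ?thesis
      using nil_space_subset_gen_eigenspace[OF f] by (intro exI[of _ f] conjI allI impI)
  qed
  show ?thesis
    unfolding alg_mult_def
  proof (rule antisym)
    show "enat M \<le> Sup {enat m | m. ?P m}"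
      using \<open>?P M\<close> by (intro Sup_upper) (simp only: mem_Collect_eq, intro exI[of _ M] conjI refl)
    show "Sup {enat m | m. ?P m} \<le> enat M"
    proof (rule Sup_least)
      fix x assume "x \<in> {enat m | m. ?P m}"
      then obtain m where m: "x = enat m \<and> ?P m" unfolding mem_Collect_eq by (rule exE)
      show "x \<le> enat M" using le[OF conjunct2[OF m]] conjunct1[OF m] by simp
    qed
  qed
qed

lemma point_spectrum_iff: "1 / lam \<in> point_spectrum phi \<longleftrightarrow> M \<noteq> 0"
proof
  assume "1 / lam \<in> point_spectrum phi"
  then obtain f where f: "L2_01 f" "\<not> ae_zero_01 f" "ae_eq_01 (Vop phi f) (\<lambda>x. 1 / lam * f x)"
    by (auto simp: point_spectrum_def)
  have "ae_zero_01 ((Vshift phi (1 / lam) ^^ 1) f)"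
    using f(3) by (simp add: ae_zero_01_def ae_eq_01_def Vshift_def)
  from ae_kernel_representative[OF L2_integrable[OF f(1)] this]
  obtain g where g: "g \<in> bint 0 1" "ae_eq_01 f g" "char_op g = 0"
    unfolding One_nat_def funpow.simps comp_id by blast
  have "g \<noteq> 0" using f(2) g(2) by (auto simp: ae_zero_01_def ae_eq_01_def)
  then show "M \<noteq> 0" using cfun.riesz_eq_0_iff[OF M] g by blast
next
  assume "M \<noteq> 0"
  then obtain f where f: "f \<in> bint 0 1" "char_op f = 0" "f \<noteq> 0"
    using cfun.riesz_eq_0_iff[OF M] by blast
  have "f \<in> cfun.nil_space (bint 0 1) char_op"
  proof -
    have "(char_op ^^ 1) f = 0" using f(2) unfolding One_nat_def funpow.simps comp_id .
    then show ?thesis using f(1) unfolding cfun.nil_space_def by blast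
  qed
  then have "\<not> ae_zero_01 f" using nil_space_ae_zero f(3) by blast
  moreover have "ae_eq_01 (Vop phi f) (\<lambda>x. 1 / lam * f x)"
    unfolding ae_eq_01_def
  proof (rule negligible_subset)
    show "{x \<in> {0..1}. Vop phi f x \<noteq> 1 / lam * f x} \<subseteq> {0}"
    proof
      fix x assume x: "x \<in> {x \<in> {0..1}. Vop phi f x \<noteq> 1 / lam * f x}"
      have "Vop phi f x = 1 / lam * f x" if "x \<in> {0<..1}"
        using fun_cong[OF f(2), of x] that lam by (simp add: char_op_def Vop_def Vblock_def field_simps)
      then show "x \<in> {0}" using x by (cases "x = 0") auto
    qed
  qed simp
  ultimately show "1 / lam \<in> point_spectrum phi"
    using bint_L2[OF f(1)] by (auto simp: point_spectrum_def)
qed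

end

end

section \<open>Assembling the blocks\<close>

theorem theorem5p2:
  fixes phi :: "real \<Rightarrow> real" and a :: "nat \<Rightarrow> real" and k :: nat and lam :: complex
  assumes "continuous_on {0..1} phi"
    and "strict_mono_on {0..1} phi"
    and "phi ` {0..1} \<subseteq> {0..1}"
    and "k \<ge> 2"
    and "a 0 = 0" and "a k = 1"
    and "\<And>i. i < k \<Longrightarrow> a i < a (Suc i)"
    and "{x \<in> {0<..<1}. phi x = x} = a ` {1..k-1}"
    and "lam \<noteq> 0"
  shows "(1 / lam \<in> point_spectrum phi \<longleftrightarrow>
           (\<Prod>i=1..k. Dfun (subphi phi a i) (complex_of_real (a i - a (i - 1)) * lam)) = 0)
       \<and> alg_mult phi (1 / lam) =
           enat (nat (zorder (\<lambda>z. \<Prod>i=1..k. Dfun (subphi phi a i) (complex_of_real (a i - a (i - 1)) * z)) lam))"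
proof -
  note cont = assms(1) and maps = assms(3) and lam = assms(9)
  have mono: "mono_on {0..1} phi"
    using strict_mono_on_imp_mono_on[OF assms(2)] .
  have a_less: "a i < a j" if "i < j" "j \<le> k" for i j
    using that
  proof (induction j)
    case (Suc j)
    then show ?case using assms(7)[of j] by (cases "i = j") auto
  qed simp
  then have a_le: "a i \<le> a j" if "i \<le> j" "j \<le> k" for i j
    using that by (cases "i = j") (auto intro: less_imp_le)
  have a_in: "a i \<in> {0..1}" if "i \<le> k" for i
    using a_le[of 0 i] a_le[of i k] that assms(5,6) by simp
  have a_sub: "{a i..a j} \<subseteq> {0..1}" if "i \<le> k" "j \<le> k" for i j
    using a_in[OF that(1)] a_in[OF that(2)] by auto
  have fixpoint: "phi (a i) = a i" if "0 < i" "i < k" for i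
  proof -
    have "a i \<in> a ` {1..k-1}" using that by auto
    then show ?thesis using assms(8) by blast
  qed
  \<comment> \<open>Inner endpoints are fixed, so monotonicity gives the bounds there. The outer
    endpoints 0 and 1 need not be fixed; at them the range of \<open>phi\<close> is used
    instead.\<close>
  have a_maps: "phi ` {a i..a j} \<subseteq> {a i..a j}" if ij: "i < j" "j \<le> k" for i j
  proof
    fix y assume "y \<in> phi ` {a i..a j}"
    then obtain x where x: "y = phi x" "a i \<le> x" "x \<le> a j" by auto
    have x01: "x \<in> {0..1}" using a_sub[of i j] x ij by auto
    then have phi01: "phi x \<in> {0..1}" using maps by (auto simp: image_subset_iff)
    have "a i \<le> phi x"
    proof (cases "i = 0")
      case False
      then show ?thesis using mono_onD[OF mono a_in[of i] x01 x(2)] fixpoint[of i] ij by simp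
    qed (use phi01 assms(5) in simp)
    moreover have "phi x \<le> a j"
    proof (cases "j = k")
      case False
      then show ?thesis using mono_onD[OF mono x01 a_in[of j] x(3)] fixpoint[of j] ij by simp
    qed (use phi01 assms(6) in simp)
    ultimately show "y \<in> {a i..a j}" using x by simp
  qed

  \<comment> \<open>Bundles the data of one block so that exponents, cofactors and radii can be
    chosen for all blocks simultaneously.\<close>
  define Q where "Q i m h r \<longleftrightarrow> r > 0 \<and> h holomorphic_on ball lam r \<and> h lam \<noteq> 0 \<and>
    (\<forall>z\<in>ball lam r. Dfun (subphi phi a i) (of_real (a i - a (i - 1)) * z) = (z - lam) ^ m * h z) \<and>
    cfun.riesz (bint (a (i - 1)) (a i)) (\<lambda>g. g - fscale lam (Vblock phi (a (i - 1)) (a i) g)) m"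
    for i m h r
  have "\<exists>m h r. Q i m h r"
    if i: "i \<in> {1..k}" for i
    unfolding Q_def
  proof (rule riesz_block)
    have sub: "{a (i - 1)..a i} \<subseteq> {0..1}" using i by (intro a_sub) auto
    show "a (i - 1) < a i" using i by (intro a_less) auto
    show "continuous_on {a (i - 1)..a i} phi" using cont sub by (rule continuous_on_subset)
    show "mono_on {a (i - 1)..a i} phi" using mono sub by (rule mono_on_subset)
    show "phi ` {a (i - 1)..a i} \<subseteq> {a (i - 1)..a i}" using i by (intro a_maps) auto
    show "subphi phi a i s = (phi (s * (a i - a (i - 1)) + a (i - 1)) - a (i - 1)) / (a i - a (i - 1))" for s
      by (rule subphi_def)
    show "phi x \<noteq> x" if x: "x \<in> {a (i - 1)<..<a i}" for x
    proof
      assume "phi x = x"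
      moreover have "i - 1 \<le> k" "i \<le> k" using i by auto
      then have "0 \<le> a (i - 1)" "a i \<le> 1" using a_in[of "i - 1"] a_in[of i] by simp_all
      then have "x \<in> {0<..<1}" using x by simp
      ultimately have "x \<in> a ` {1..k-1}" unfolding assms(8)[symmetric] by simp
      then obtain j where j: "j \<in> {1..k-1}" "x = a j" by auto
      show False
      proof (cases "j < i")
        case True
        then have "a j \<le> a (i - 1)" using i by (intro a_le) auto
        then show False using j x by simp
      next
        case False
        then have "a i \<le> a j" using j assms(4) by (intro a_le) auto
        then show False using j x by simp
      qed
    qed
  qed (rule lam)
  then have "\<forall>i\<in>{1..k}. \<exists>m h r. Q i m h r" by blast
  from bchoice[OF this] obtain m where "\<forall>i\<in>{1..k}. \<exists>h r. Q i (m i) h r" by blast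
  from bchoice[OF this] obtain h where "\<forall>i\<in>{1..k}. \<exists>r. Q i (m i) (h i) r" by blast
  from bchoice[OF this] obtain r where Q: "\<forall>i\<in>{1..k}. Q i (m i) (h i) (r i)" by blast
  have r: "r i > 0" and h: "h i holomorphic_on ball lam (r i)" "h i lam \<noteq> 0"
    and D: "z \<in> ball lam (r i) \<Longrightarrow>
      Dfun (subphi phi a i) (of_real (a i - a (i - 1)) * z) = (z - lam) ^ m i * h i z"
    and riesz: "cfun.riesz (bint (a (i - 1)) (a i))
      (\<lambda>g. g - fscale lam (Vblock phi (a (i - 1)) (a i) g)) (m i)"
    if "i \<in> {1..k}" for i z
    using bspec[OF Q that] unfolding Q_def by blast+

  \<comment> \<open>The operator on the last \<open>k - j\<close> blocks. Downward induction starts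
    from the last block alone, \<open>j = k - 1\<close>, and adds one block on the left at each step
    until \<open>j = 0\<close>.\<close>
  define W where "W j \<longleftrightarrow>
    cfun.riesz (bint (a j) 1) (\<lambda>g. g - fscale lam (Vblock phi (a j) 1 g)) (\<Sum>i=Suc j..k. m i)" for j
  have "W 0"
  proof (rule inc_induct[of 0 "k - 1"])
    have "{Suc (k - 1)..k} = {k}" using assms(4) by auto
    then show "W (k - 1)" unfolding W_def using riesz[of k] assms(4,6) by simp
    fix n assume n: "n < k - 1" "W (Suc n)"
    have "cfun.riesz (bint (a n) 1) (\<lambda>g. g - fscale lam (Vblock phi (a n) 1 g))
        (m (Suc n) + (\<Sum>i=Suc (Suc n)..k. m i))"
    proof (rule riesz_split)
      show "a n \<le> a (Suc n)" "a (Suc n) \<le> 1" using n a_le[of n "Suc n"] a_in[of "Suc n"] by auto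
      show "continuous_on {a n..1} phi"
        using n a_in[of n] by (intro continuous_on_subset[OF cont]) auto
      show "phi ` {a n..a (Suc n)} \<subseteq> {a n..a (Suc n)}" using n by (intro a_maps) auto
      show "phi ` {a (Suc n)..1} \<subseteq> {a (Suc n)..1}" using n a_maps[of "Suc n" k] assms(6) by simp
      show "cfun.riesz (bint (a (Suc n)) 1) (\<lambda>g. g - fscale lam (Vblock phi (a (Suc n)) 1 g)) (\<Sum>i=Suc (Suc n)..k. m i)"
        using n(2) by (simp only: W_def)
      show "cfun.riesz (bint (a n) (a (Suc n))) (\<lambda>g. g - fscale lam (Vblock phi (a n) (a (Suc n)) g)) (m (Suc n))"
        using riesz[of "Suc n"] n by simp
    qed
    then show "W n" unfolding W_def using n by (subst sum.atLeast_Suc_atMost) auto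
  qed simp
  define M where "M = (\<Sum>i=1..k. m i)"
  have M: "cfun.riesz (bint 0 1) (char_op phi lam) M"
    using \<open>W 0\<close> unfolding W_def M_def char_op_def[OF cont maps lam, abs_def] assms(5) by simp

  let ?D = "\<lambda>z. \<Prod>i=1..k. Dfun (subphi phi a i) (complex_of_real (a i - a (i - 1)) * z)"
  let ?h = "\<lambda>z. \<Prod>i=1..k. h i z"
  \<comment> \<open>A common radius on which all the local factorizations hold; multiplying them
    adds the exponents to \<open>M\<close>.\<close>
  define R where "R = Min (r ` {1..k})"
  have R_le: "ball lam R \<subseteq> ball lam (r i)" if "i \<in> {1..k}" for i
    using that unfolding R_def by (intro subset_ball Min_le) auto
  have R: "R > 0" using r assms(4) by (simp add: R_def)
  have D_eq: "?D z = (z - lam) ^ M * ?h z" if z: "z \<in> ball lam R" for z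
  proof -
    have "?D z = (\<Prod>i=1..k. (z - lam) ^ m i * h i z)"
    proof (rule prod.cong[OF refl])
      fix i assume "i \<in> {1..k}"
      from D[OF this] R_le[OF this] z
      show "Dfun (subphi phi a i) (complex_of_real (a i - a (i - 1)) * z) = (z - lam) ^ m i * h i z"
        by (simp only: subset_iff)
    qed
    then show ?thesis by (simp add: prod.distrib M_def power_sum)
  qed
  have h_nz: "?h lam \<noteq> 0" using h(2) by simp
  have "zorder ?D lam = int M"
  proof (rule zorder_eqI)
    show "?h holomorphic_on ball lam R"
      using R_le by (intro holomorphic_on_prod holomorphic_on_subset[OF h(1)]) auto
    show "?D w = ?h w * (w - lam) powi int M" if "w \<in> ball lam R" for w
      using D_eq[OF that] by simp
  qed (use R h_nz in auto)
  moreover have "?D lam = 0 \<longleftrightarrow> M \<noteq> 0"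
    using D_eq[of lam] R h_nz by (cases "M = 0") auto
  ultimately show ?thesis
    using alg_mult_eq[OF cont maps lam M] point_spectrum_iff[OF cont maps lam M] by simp
qed

end
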